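(* Let $n\geqslant 4$ be an integer and let $A$ be a complex abelian variety with a group of automorphisms $G$ isomorphic to $Q(2^n)$. Assume that the analytic representation of the action of $G$ on $A$ decomposes as a sum of irreducible representations as $$\rho_a\simeq \bigoplus_{j=1}^4 a_j\chi_j\ \oplus\ \bigoplus_{s=1}^{2^{n-2}-1} b_s\Theta_s$$ for some non-negative integers $a_1,\dots,a_4,b_1,\dots,b_{2^{n-2}-1}$. For each $j\in\{2,\dots,n-2\}$ choose $t_j\in\mathbb{Z}_{2^{n-1}}$ such that $\omega\mapsto\omega^{t_j}$ generates the Galois group associated to the character field of $\Theta_{2^{j-1}}$ (which is isomorphic to the cyclic group of order $2^{n-j-2}$). Then $$b_1=b_3=\cdots=b_{2^{n-2}-1}\quad\text{and}\quad b_{2^{j-1}}=b_{t_j^k2^{j-1}}\ \text{ for each } 0\leqslant k\leqslant 2^{n-j-2}-1 \text{ and each } j\in\{2,\dots,n-2\},$$ and the following dimension formulas hold: $$\dim A_G=a_1,\qquad \dim\mathrm{Prym}(A_{N_i}/A_G)=a_{i+1}\ (i=1,2,3),\qquad \dim\mathrm{Prym}(A/A_Z)=2^{n-2}b_1,$$ $$\dim\mathrm{Prym}(A_{H_j}/A_{H_{j+1}})=\dim\mathrm{Prym}(A_{\tilde H_j}/A_{\tilde H_{j+1}})=2^{n-j-2}\,b_{2^{j-1}}\quad (2\leqslant j\leqslant n-2).$$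
   Context: $Q(2^n)=\langle x,y : x^{2^{n-1}}=1,\ y^2x^{2^{n-2}}=1,\ yxy^{-1}x=1\rangle$, of order $2^n$; $G$ is identified with it. Subgroups: $H_j=\langle x^{2^{n-j}},y\rangle$, $\tilde H_j=\langle x^{2^{n-j}},xy\rangle$ ($2\leqslant j\leqslant n-1$), $Z=\langle y^2\rangle$, $N_1=\langle x\rangle$, $N_2=H_{n-1}=\langle x^2,y\rangle$, $N_3=\tilde H_{n-1}=\langle x^2,xy\rangle$. Write $A=V/\Lambda$. $G$ is a finite group of automorphisms of $A$ fixing the origin; its analytic representation is $\rho_a:G\to\mathrm{GL}(V)$. With $\Xi:\mathbb{Q}[G]\to\mathrm{End}(A)\otimes\mathbb{Q}$ the induced homomorphism, for $K\leqslant G$ put $A_K=\mathrm{Im}\,\Xi(\sum_{k\in K}k)$. For $K_1\leqslant K_2$ one has $A_{K_2}\subseteq A_{K_1}$, and $\mathrm{Prym}(A_{K_1}/A_{K_2})$ denotes an abelian subvariety $P$ of $A_{K_1}$ with $A_{K_1}\sim P\times A_{K_2}$ ($\sim$ is isogeny). Complex irreducible representations of $Q(2^n)$: the degree one representations $\chi_1: x,y\mapsto 1$; $\chi_2:x\mapsto 1,\,y\mapsto -1$; $\chi_3:x\mapsto -1,\,y\mapsto 1$; $\chi_4:x,y\mapsto -1$; and, with $\omega=\exp(2\pi i/2^{n-1})$, the degree two representations $\Theta_s:x\mapsto \mathrm{diag}(\omega^s,\bar\omega^s),\ y\mapsto\begin{pmatrix}0&(-1)^s\\1&0\end{pmatrix}$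 for $s\in\{1,\dots,2^{n-2}-1\}$. Indices of $\Theta$ are read modulo $2^{n-1}$ and up to sign (since $\Theta_s\simeq\Theta_{-s}$), so that $b_{t_j^k2^{j-1}}$ is the multiplicity in $\rho_a$ of $\Theta_{t_j^k2^{j-1}}$. The character field of $\Theta_{2^{j-1}}$ is $\mathbb{Q}(\omega^{2^{j-1}}+\bar\omega^{2^{j-1}})$. The listed subvarieties are the factors of the group algebra decompositions $A\sim A_G\times\prod_{i=1}^3\mathrm{Prym}(A_{N_i}/A_G)\times\mathrm{Prym}(A/A_Z)\times\prod_{j=2}^{n-2}\mathrm{Prym}(A_{H_j}/A_{H_{j+1}})^2$ and the analogous one with $\tilde H_j$ in place of $H_j$. *)

theory Defs
  imports
    "HOL-Analysis.Analysis"
    "HOL-Algebra.Bij"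
    "HOL-Algebra.Generated_Fields"
    "Jordan_Normal_Form.Matrix"
begin

section \<open>Groups given by generators and relators\<close>

text \<open>A word is a list of letters; \<open>(a, True)\<close> stands for the generator \<open>a\<close>
  and \<open>(a, False)\<close> for its formal inverse.\<close>

type_synonym 'a word = "('a \<times> bool) list"

inductive word_eq :: "'a word set \<Rightarrow> 'a word \<Rightarrow> 'a word \<Rightarrow> bool" for R where
  refl: "word_eq R u u"
| sym: "word_eq R u v \<Longrightarrow> word_eq R v u"
| trans: "word_eq R u v \<Longrightarrow> word_eq R v w \<Longrightarrow> word_eq R u w"
| append: "word_eq R u u' \<Longrightarrow> word_eq R v v' \<Longrightarrow> word_eq R (u @ v) (u' @ v')"
| cancel: "word_eq R [(a, b), (a, \<not> b)] []"
| relator: "r \<in> R \<Longrightarrow> word_eq R r []"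

definition word_class :: "'a word set \<Rightarrow> 'a word \<Rightarrow> 'a word set" where
  "word_class R u = {v. word_eq R u v}"

definition presented_group :: "'a word set \<Rightarrow> 'a word set monoid" where
  "presented_group R =
    \<lparr>carrier = range (word_class R),
     mult = (\<lambda>C D. {w. \<exists>u\<in>C. \<exists>v\<in>D. word_eq R (u @ v) w}),
     one = word_class R []\<rparr>"

definition word_eval :: "('m, 'x) monoid_scheme \<Rightarrow> ('a \<Rightarrow> 'm) \<Rightarrow> 'a word \<Rightarrow> 'm" where
  "word_eval M f w =
    foldr (\<lambda>(a, b) m. (if b then f a else inv\<^bsub>M\<^esub> (f a)) \<otimes>\<^bsub>M\<^esub> m) w \<one>\<^bsub>M\<^esub>"

text \<open>The homomorphism from a presented group determined by the images of the generators,
  which must be units satisfying the relators; then \<open>word_eval\<close> is constant on each class.\<close>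

definition presented_hom :: "('m, 'x) monoid_scheme \<Rightarrow> ('a \<Rightarrow> 'm) \<Rightarrow> 'a word set \<Rightarrow> 'm" where
  "presented_hom M f C = the_elem (word_eval M f ` C)"


section \<open>The generalized quaternion group\<close>

datatype gen = GX | GY

definition quat_relators :: "nat \<Rightarrow> gen word set" where
  "quat_relators n =
    {replicate (2 ^ (n - 1)) (GX, True),
     [(GY, True), (GY, True)] @ replicate (2 ^ (n - 2)) (GX, True),
     [(GY, True), (GX, True), (GY, False), (GX, True)]}"

definition quat :: "nat \<Rightarrow> gen word set monoid" where
  "quat n = presented_group (quat_relators n)"

definition quat_x :: "nat \<Rightarrow> gen word set" where
  "quat_x n = word_class (quat_relators n) [(GX, True)]"

definition quat_y :: "nat \<Rightarrow> gen word set" where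
  "quat_y n = word_class (quat_relators n) [(GY, True)]"

definition sub_H :: "nat \<Rightarrow> nat \<Rightarrow> gen word set set" where
  "sub_H n j = generate (quat n) {quat_x n [^]\<^bsub>quat n\<^esub> (2 ^ (n - j) :: nat), quat_y n}"

definition sub_Ht :: "nat \<Rightarrow> nat \<Rightarrow> gen word set set" where
  "sub_Ht n j = generate (quat n)
    {quat_x n [^]\<^bsub>quat n\<^esub> (2 ^ (n - j) :: nat), quat_x n \<otimes>\<^bsub>quat n\<^esub> quat_y n}"

definition sub_Z :: "nat \<Rightarrow> gen word set set" where
  "sub_Z n = generate (quat n) {quat_y n \<otimes>\<^bsub>quat n\<^esub> quat_y n}"

definition sub_N :: "nat \<Rightarrow> nat \<Rightarrow> gen word set set" where
  "sub_N n i =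
    (if i = 1 then generate (quat n) {quat_x n}
     else if i = 2 then sub_H n (n - 1)
     else sub_Ht n (n - 1))"


section \<open>Matrix representations of the generalized quaternion group\<close>

definition quat_rep ::
  "nat \<Rightarrow> complex mat \<Rightarrow> complex mat \<Rightarrow> gen word set \<Rightarrow> complex mat" where
  "quat_rep d X Y = presented_hom (ring_mat TYPE(complex) d ()) (case_gen X Y)"

definition chi :: "nat \<Rightarrow> gen word set \<Rightarrow> complex mat" where
  "chi j = quat_rep 1
    (mat_of_rows_list 1 [[if j \<in> {1, 2} then 1 else - 1]])
    (mat_of_rows_list 1 [[if j \<in> {1, 3} then 1 else - 1]])"

definition omega :: "nat \<Rightarrow> complex" where
  "omega n = exp (2 * of_real pi * \<i> / 2 ^ (n - 1))"

definition Theta :: "nat \<Rightarrow> nat \<Rightarrow> gen word set \<Rightarrow> complex mat" where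
  "Theta n s = quat_rep 2
    (mat_of_rows_list 2 [[omega n ^ s, 0], [0, cnj (omega n) ^ s]])
    (mat_of_rows_list 2 [[0, (- 1) ^ s], [1, 0]])"

text \<open>The representative in \<open>{0..2 ^ (n - 2)}\<close> of an index \<open>m\<close> of \<open>Theta\<close> taken
  modulo \<open>2 ^ (n - 1)\<close> and up to sign.\<close>

definition Theta_index :: "nat \<Rightarrow> nat \<Rightarrow> nat" where
  "Theta_index n m = min (m mod 2 ^ (n - 1)) (2 ^ (n - 1) - m mod 2 ^ (n - 1))"

definition rep_sum :: "nat \<Rightarrow> (nat \<Rightarrow> nat) \<Rightarrow> (nat \<Rightarrow> nat) \<Rightarrow> gen word set \<Rightarrow> complex mat" where
  "rep_sum n a b q = diag_block_mat
    (concat (map (\<lambda>j. replicate (a j) (chi j q)) [1..<5]) @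
     concat (map (\<lambda>s. replicate (b s) (Theta n s q)) [1..<2 ^ (n - 2)]))"

text \<open>A linear action on \<open>complex ^ 'g\<close> is equivalent to a matrix representation if the latter
  gives the matrices of the action with respect to some basis \<open>es\<close>.\<close>

definition rep_equiv ::
  "('q, 'x) monoid_scheme \<Rightarrow> ('q \<Rightarrow> complex ^ 'g \<Rightarrow> complex ^ 'g) \<Rightarrow> ('q \<Rightarrow> complex mat) \<Rightarrow> bool"
  where
  "rep_equiv Q \<rho> M \<longleftrightarrow>
    (\<exists>es. distinct es \<and> vec.independent (set es) \<and> vec.span (set es) = UNIV \<and>
      (\<forall>q\<in>carrier Q. M q \<in> carrier_mat (length es) (length es) \<and>
        (\<forall>k<length es. \<rho> q (es ! k) = (\<Sum>i<length es. M q $$ (i, k) *s es ! i))))"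


section \<open>Complex tori and abelian varieties\<close>

text \<open>A complex torus \<open>W / L\<close>, with \<open>W\<close> a complex subspace of \<open>complex ^ 'n\<close>. Keeping \<open>W\<close>
  as a subspace lets a subtorus of \<open>V / \<Lambda>\<close> be recorded as \<open>W / (W \<inter> \<Lambda>)\<close>.\<close>

record 'n::finite torus =
  tangent :: "(complex ^ 'n) set"
  periods :: "(complex ^ 'n) set"

definition complex_torus :: "'n::finite torus \<Rightarrow> bool" where
  "complex_torus T \<longleftrightarrow>
    vec.subspace (tangent T) \<and>
    0 \<in> periods T \<and> (\<forall>u\<in>periods T. \<forall>v\<in>periods T. u - v \<in> periods T) \<and>
    discrete (periods T) \<and> span (periods T) = tangent T"

definition polarization ::
  "'n::finite torus \<Rightarrow> (complex ^ 'n \<Rightarrow> complex ^ 'n \<Rightarrow> complex) \<Rightarrow> bool" where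
  "polarization T H \<longleftrightarrow>
    (\<forall>u\<in>tangent T. \<forall>v\<in>tangent T. \<forall>w\<in>tangent T. H (u + v) w = H u w + H v w) \<and>
    (\<forall>c. \<forall>u\<in>tangent T. \<forall>v\<in>tangent T. H (c *s u) v = c * H u v) \<and>
    (\<forall>u\<in>tangent T. \<forall>v\<in>tangent T. H v u = cnj (H u v)) \<and>
    (\<forall>u\<in>tangent T. u \<noteq> 0 \<longrightarrow> 0 < Re (H u u)) \<and>
    (\<forall>u\<in>periods T. \<forall>v\<in>periods T. Im (H u v) \<in> \<int>)"

definition abelian_variety :: "'n::finite torus \<Rightarrow> bool" where
  "abelian_variety T \<longleftrightarrow> complex_torus T \<and> (\<exists>H. polarization T H)"

definition torus_dim :: "'n::finite torus \<Rightarrow> nat" where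
  "torus_dim T = vec.dim (tangent T)"

definition torus_proj :: "'n::finite torus \<Rightarrow> complex ^ 'n \<Rightarrow> (complex ^ 'n) set" where
  "torus_proj T v = (+) v ` periods T"

definition torus_points :: "'n::finite torus \<Rightarrow> (complex ^ 'n) set set" where
  "torus_points T = torus_proj T ` tangent T"

text \<open>The holomorphic group homomorphisms between complex tori are the maps induced by
  complex linear maps between the tangent spaces preserving the periods.\<close>

definition torus_hom ::
  "'m::finite torus \<Rightarrow> 'n::finite torus \<Rightarrow> ((complex ^ 'm) set \<Rightarrow> (complex ^ 'n) set) \<Rightarrow> bool"
  where
  "torus_hom S T f \<longleftrightarrow>
    (\<exists>F. Vector_Spaces.linear (*s) (*s) F \<and>
      F ` tangent S \<subseteq> tangent T \<and> F ` periods S \<subseteq> periods T \<and>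
      (\<forall>v\<in>tangent S. f (torus_proj S v) = torus_proj T (F v)))"

text \<open>The origin of \<open>T\<close> is the coset \<open>periods T\<close>.\<close>

definition isogeny ::
  "'m::finite torus \<Rightarrow> 'n::finite torus \<Rightarrow> ((complex ^ 'm) set \<Rightarrow> (complex ^ 'n) set) \<Rightarrow> bool"
  where
  "isogeny S T f \<longleftrightarrow>
    torus_hom S T f \<and> f ` torus_points S = torus_points T \<and>
    finite {p \<in> torus_points S. f p = periods T}"

definition isogenous :: "'m::finite torus \<Rightarrow> 'n::finite torus \<Rightarrow> bool" where
  "isogenous S T \<longleftrightarrow> (\<exists>f. isogeny S T f)"

definition torus_prod ::
  "'m::finite torus \<Rightarrow> 'n::finite torus \<Rightarrow> ('m + 'n) torus" where
  "torus_prod S T =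
    \<lparr>tangent = {v. (\<chi> i. v $ Inl i) \<in> tangent S \<and> (\<chi> j. v $ Inr j) \<in> tangent T},
     periods = {v. (\<chi> i. v $ Inl i) \<in> periods S \<and> (\<chi> j. v $ Inr j) \<in> periods T}\<rparr>"

text \<open>Complex subtori of abelian varieties are again polarized, by restriction.\<close>

definition abelian_subvariety :: "'n::finite torus \<Rightarrow> 'n torus \<Rightarrow> bool" where
  "abelian_subvariety P B \<longleftrightarrow>
    complex_torus P \<and> tangent P \<subseteq> tangent B \<and> periods P = tangent P \<inter> periods B"

text \<open>\<open>is_prym B C P\<close>: \<open>P\<close> is a Prym variety \<open>Prym(B/C)\<close>.\<close>

definition is_prym :: "'n::finite torus \<Rightarrow> 'n torus \<Rightarrow> 'n torus \<Rightarrow> bool" where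
  "is_prym B C P \<longleftrightarrow> abelian_subvariety P B \<and> isogenous B (torus_prod P C)"


section \<open>Group actions on abelian varieties\<close>

definition torus_Aut :: "'g::finite torus \<Rightarrow> ((complex ^ 'g) set \<Rightarrow> (complex ^ 'g) set) monoid" where
  "torus_Aut A =
    (BijGroup (torus_points A))\<lparr>carrier := {f \<in> Bij (torus_points A). torus_hom A A f}\<rparr>"

text \<open>Meant for tori with \<open>tangent A = UNIV\<close>, where the linear lift is unique.\<close>

definition analytic_rep ::
  "'g::finite torus \<Rightarrow> ((complex ^ 'g) set \<Rightarrow> (complex ^ 'g) set) \<Rightarrow> complex ^ 'g \<Rightarrow> complex ^ 'g"
  where
  "analytic_rep A f =
    (THE F. Vector_Spaces.linear (*s) (*s) F \<and> (\<forall>v. f (torus_proj A v) = torus_proj A (F v)))"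

text \<open>The image of the endomorphism of \<open>V / \<Lambda>\<close> with analytic representation \<open>F\<close> is
  \<open>(F V + \<Lambda>) / \<Lambda>\<close>, that is \<open>F V / (F V \<inter> \<Lambda>)\<close>.\<close>

definition torus_image ::
  "'g::finite torus \<Rightarrow> (complex ^ 'g \<Rightarrow> complex ^ 'g) \<Rightarrow> 'g torus" where
  "torus_image A F = \<lparr>tangent = F ` tangent A, periods = F ` tangent A \<inter> periods A\<rparr>"

text \<open>\<open>A\<^sub>K\<close>: the sum of the elements of \<open>K\<close> lies in the integral group ring, so it induces
  an honest endomorphism of \<open>A\<close>, whose analytic representation is the sum below.\<close>

definition fixed_part ::
  "'g::finite torus \<Rightarrow> ('q \<Rightarrow> (complex ^ 'g) set \<Rightarrow> (complex ^ 'g) set) \<Rightarrow> 'q set \<Rightarrow> 'g torus" where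
  "fixed_part A \<phi> K = torus_image A (\<lambda>v. \<Sum>k\<in>K. analytic_rep A (\<phi> k) v)"


section \<open>Character fields and their Galois groups\<close>

definition complex_field :: "complex ring" where
  "complex_field = \<lparr>carrier = UNIV, mult = (*), one = 1, zero = 0, add = (+)\<rparr>"

text \<open>The subfield of the complex numbers generated by \<open>S\<close>; it contains the rationals.\<close>

definition adjoin :: "complex set \<Rightarrow> complex set" where
  "adjoin S = generate_field complex_field S"

text \<open>The Galois group over the rationals, which every field automorphism fixes.\<close>

definition Gal :: "complex set \<Rightarrow> (complex \<Rightarrow> complex) set" where
  "Gal K = Bij K \<inter>
    ring_iso (complex_field\<lparr>carrier := K\<rparr>) (complex_field\<lparr>carrier := K\<rparr>)"

definition char_field :: "nat \<Rightarrow> nat \<Rightarrow> complex set" where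
  "char_field n s = adjoin {omega n ^ s + cnj (omega n) ^ s}"

text \<open>The automorphism of \<open>\<rat>(\<omega>)\<close> with \<open>\<omega> \<mapsto> \<omega> ^ t\<close> exists and its restriction
  generates the Galois group of the character field of \<open>Theta n s\<close>.\<close>

definition galois_generator :: "nat \<Rightarrow> nat \<Rightarrow> nat \<Rightarrow> bool" where
  "galois_generator n s t \<longleftrightarrow>
    (\<exists>\<sigma>\<in>Gal (adjoin {omega n}). \<sigma> (omega n) = omega n ^ t \<and>
      generate (BijGroup (char_field n s)) {restrict \<sigma> (char_field n s)} = Gal (char_field n s))"

end

theory Submission
  imports Defs
begin

text \<open>Everything is read off from traces. The sum of the elements of a subgroup \<open>K\<close> is \<open>card K\<close>
  times a projection, so \<open>dim A\<^sub>K\<close> is the average over \<open>K\<close> of the character of \<open>\<rho>\<^sub>a\<close>; each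
  subgroup in question consists of the powers of some \<open>x\<^sup>d\<close> and possibly a coset of these, and the
  averages are sums of roots of unity. An isogeny lifts to a linear isomorphism of tangent spaces,
  so the dimension of a Prym variety is a difference of two such averages.

  The equalities between the \<open>b\<^sub>s\<close> come from rationality: the periods span a
  rational structure of \<open>V\<close> preserved by \<open>G\<close>, so the real traces, which are twice the values
  of the real character of \<open>\<rho>\<^sub>a\<close>, are rational. By Fourier inversion on \<open>\<langle>x\<rangle>\<close> the number
  \<open>2\<^bsup>n-1\<^esup> b\<^sub>m\<close> is the value at \<open>\<omega>\<^sup>m\<close> of one fixed rational polynomial, and roots of unity
  of the same two-power order are conjugate.\<close>

section \<open>Galois conjugate roots of unity of two-power order\<close>

text \<open>Two facts have to be earned. The relations bound the presented group only from above;
  that the 2^n normal forms x^i and x^i y are distinct is detected by the matrices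
  \<open>Theta n 1\<close>. That roots of unity of equal two-power order are conjugate is
  Eisenstein's criterion at 2, since X^(2^l) + 1 becomes (1 + X)^(2^l) + 1 after a shift. Conjugacy
  makes b_s depend only on the 2-adic valuation of s. The Galois generators t_j are odd, so
  multiplying an index by their powers preserves its valuation. A subgroup whose cyclic part has
  order r has fixed vectors in exactly those \<Theta>_s with r dividing s. Passing from H_j to
  H_(j+1) therefore loses the indices of valuation j - 1; there are 2^(n-j-2) of them, each losing
  one dimension. From A to A_Z the odd indices are lost, 2^(n-3) in number, each with both
  dimensions of \<Theta>_s, whence 2^(n-2).\<close>

hide_const (open) up_ring.coeff up_ring.monom module.smult

text \<open>As p^2 does not divide the constant term, one factor has a constant term prime to p.
  Convolution then forces p to divide the coefficients of the other factor one after the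
  other.\<close>

lemma eisenstein:
  fixes f g :: "int poly"
  assumes p: "prime p"
    and low: "\<And>i. i < degree (f * g) \<Longrightarrow> p dvd coeff (f * g) i"
    and lead: "\<not> p dvd lead_coeff (f * g)"
    and const: "\<not> p\<^sup>2 dvd coeff (f * g) 0"
  shows "degree f = 0 \<or> degree g = 0"
proof -
  have aux: "degree g = 0"
    if low: "\<And>i. i < degree (f * g) \<Longrightarrow> p dvd coeff (f * g) i"
      and lead: "\<not> p dvd lead_coeff (f * g)" and g0: "\<not> p dvd coeff g 0"
    for f g :: "int poly"
  proof (rule ccontr)
    assume dg: "degree g \<noteq> 0"
    have nz: "f \<noteq> 0" "g \<noteq> 0" using lead by auto
    have deg: "degree (f * g) = degree f + degree g"
      using nz by (rule degree_mult_eq)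
    \<comment> \<open>For \<open>degree g\<close> positive the range contains
      \<open>degree f\<close>, which contradicts \<open>lead\<close>.\<close>
    have "p dvd coeff f i" if "i < degree (f * g)" for i
      using that
    proof (induction i rule: less_induct)
      case (less i)
      have "coeff (f * g) i = (\<Sum>k<i. coeff f k * coeff g (i - k)) + coeff f i * coeff g 0"
        by (simp add: coeff_mult flip: lessThan_Suc_atMost)
      moreover have "p dvd (\<Sum>k<i. coeff f k * coeff g (i - k))"
        using less by (intro dvd_sum dvd_mult2) auto
      ultimately have "p dvd coeff f i * coeff g 0"
        using low[OF less.prems] by (simp add: dvd_add_right_iff)
      then show ?case using g0 p by (simp add: prime_dvd_mult_iff)
    qed
    then have "p dvd lead_coeff f" using dg deg by simp
    then show False using lead by (simp add: lead_coeff_mult)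
  qed
  have "coeff (f * g) 0 = coeff f 0 * coeff g 0"
    by (simp add: coeff_mult)
  then have "\<not> p dvd coeff f 0 \<or> \<not> p dvd coeff g 0"
    using const by (auto simp: power2_eq_square intro: mult_dvd_mono)
  then show ?thesis
    using aux[of f g] aux[of g f] assms by (auto simp: mult.commute)
qed

lemma smult_2: "smult 2 (p :: int poly) = 2 * p"
  by (simp add: numeral_poly)

text \<open>Frobenius modulo 2, with the error kept as an explicit polynomial.\<close>

lemma one_plus_X_two_power:
  "\<exists>r :: int poly. [:1, 1:] ^ (2 ^ l) = monom 1 (2 ^ l) + 1 + smult 2 r"
proof (induction l)
  case 0
  have "[:1, 1:] = monom 1 1 + (1 :: int poly)"
    by (simp add: monom_Suc one_pCons flip: pCons_one)
  then show ?case by (intro exI[of _ 0]) simp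
next
  case (Suc l)
  then obtain r :: "int poly" where r: "[:1, 1:] ^ (2 ^ l) = monom 1 (2 ^ l) + 1 + smult 2 r" ..
  let ?m = "monom 1 (2 ^ l) :: int poly"
  have "[:1, 1:] ^ (2 ^ Suc l) = ([:1, 1:] ^ (2 ^ l))\<^sup>2"
    by (simp add: power_even_eq)
  also have "\<dots> = ?m\<^sup>2 + 1 + 2 * (?m + 2 * r * (?m + 1) + 2 * r\<^sup>2)"
    unfolding r by (simp add: power2_eq_square algebra_simps smult_2)
  \<comment> \<open>The new error is half of the difference between the square of
    \<open>?m + 1 + 2 * r\<close> and \<open>?m\<^sup>2 + 1\<close>.\<close>
  finally show ?case
    by (intro exI[of _ "?m + 2 * r * (?m + 1) + 2 * r\<^sup>2"])
       (simp add: monom_power smult_2 mult.commute)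
qed

lemma pcompose_monom: "pcompose (monom 1 n) q = (q :: int poly) ^ n"
  by (induction n) (auto simp: monom_Suc pcompose_pCons monom_0)

text \<open>Substituting X + 1 for X preserves degrees and products. It produces (1 + X)^(2^l) + 1,
  whose lower coefficients are even and whose constant term 2 is not divisible by 4.\<close>

lemma two_power_cyclotomic_factor:
  fixes f g :: "int poly"
  assumes fg: "monom 1 (2 ^ l) + 1 = f * g"
  shows "degree f = 0 \<or> degree g = 0"
proof -
  let ?s = "\<lambda>f :: int poly. pcompose f [:1, 1:]"
  obtain r :: "int poly" where r: "[:1, 1:] ^ (2 ^ l) = monom 1 (2 ^ l) + 1 + smult 2 r"
    using one_plus_X_two_power by blast
  have deg: "degree (?s h) = degree h" for h :: "int poly"
    by (simp add: degree_pcompose)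
  have prod: "?s f * ?s g = ?s (monom 1 (2 ^ l) + 1)"
    by (simp add: fg pcompose_mult)
  also have "\<dots> = [:1, 1:] ^ (2 ^ l) + 1"
    by (simp add: pcompose_add pcompose_monom pcompose_1)
  finally have eq: "?s f * ?s g = [:1, 1:] ^ (2 ^ l) + 1" .
  have c0: "coeff (?s f * ?s g) 0 = 2"
    unfolding eq by (simp add: coeff_0_power)
  have d: "degree (?s f * ?s g) = 2 ^ l"
    unfolding prod deg by (simp add: degree_add_eq_left degree_monom_eq)
  have lead: "lead_coeff (?s f * ?s g) = 1"
    unfolding d unfolding eq by (subst coeff_add) (simp add: coeff_linear_power)
  have "2 dvd coeff (?s f * ?s g) i" if "i < degree (?s f * ?s g)" for i
  proof -
    have "i < 2 ^ l" using that d by simp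
    then show ?thesis unfolding eq r coeff_add coeff_smult by (cases "i = 0") (auto simp: coeff_1)
  qed
  then have "degree (?s f) = 0 \<or> degree (?s g) = 0"
    using c0 lead by (intro eisenstein[of 2]) auto
  then show ?thesis unfolding deg .
qed

section \<open>Vanishing of rational polynomials at conjugate roots of unity\<close>

abbreviation cpoly :: "int poly \<Rightarrow> complex poly" where
  "cpoly \<equiv> map_poly of_int"

lemma cpoly_simps:
  "cpoly (f * g) = cpoly f * cpoly g" "cpoly (f + g) = cpoly f + cpoly g"
  "cpoly (f - g) = cpoly f - cpoly g" "cpoly (smult c f) = smult (of_int c) (cpoly f)"
  "cpoly (monom c n) = monom (of_int c) n" "cpoly 1 = 1" "cpoly [:c:] = [:of_int c:]"
  by (auto intro!: poly_eqI simp: coeff_map_poly coeff_mult coeff_pCons split: nat.split)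

text \<open>A minimal polynomial argument over the integers: a primitive \<open>g\<close> of least
  degree vanishing at z divides everything that vanishes at z. It divides X^(2^l) + 1 with constant
  cofactor, so x is one of its roots.\<close>

lemma two_power_cyclotomic_conjugate_int:
  fixes p :: "int poly"
  assumes z: "z ^ (2 ^ l) = -1" and x: "x ^ (2 ^ l) = -1" and p: "poly (cpoly p) z = 0"
  shows "poly (cpoly p) x = 0"
proof (cases "p = 0")
  case False
  define q :: "int poly" where "q = monom 1 (2 ^ l) + 1"
  have q: "poly (cpoly q) w = w ^ (2 ^ l) + 1" for w
    unfolding q_def by (simp add: cpoly_simps poly_monom)
  let ?S = "\<lambda>p. p \<noteq> 0 \<and> poly (cpoly p) z = 0"
  obtain h where h: "?S h" and min: "\<And>h'. ?S h' \<Longrightarrow> degree h \<le> degree h'"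
    using exists_least_iff[of "\<lambda>d. \<exists>p. ?S p \<and> degree p = d"] False p
    by (metis not_le_imp_less)
  define g where "g = primitive_part h"
  have "cpoly h = smult (of_int (Polynomial.content h)) (cpoly g)"
    unfolding g_def
    by (intro poly_eqI) (metis coeff_map_poly coeff_smult content_times_primitive_part of_int_0 of_int_mult)
  then have g: "?S g" "Polynomial.content g = 1" and dg: "degree g = degree h"
    using h by (auto simp: g_def)
  \<comment> \<open>Pseudo-division leaves a remainder that vanishes at z and has smaller degree,
    hence is 0. As \<open>g\<close> is primitive, multiplicativity of contents shows that the
    multiplier \<open>a\<close> divides the content of \<open>u\<close>, so it cancels.\<close>
  have dvd: "g dvd f" if f: "poly (cpoly f) z = 0" for f
  proof -
    obtain a u where a: "a \<noteq> 0" and u: "smult a f = g * u + pseudo_mod f g"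
      using pseudo_mod(1)[of g f] g by blast
    have "pseudo_mod f g = smult a f - g * u" using u by simp
    moreover have "poly (cpoly (smult a f - g * u)) z = 0"
      using f g by (simp add: cpoly_simps)
    ultimately have "pseudo_mod f g = 0"
      using min[of "pseudo_mod f g"] pseudo_mod(2)[of g f] g dg by fastforce
    then have "smult a f = g * u" using u by simp
    moreover from this have "Polynomial.content u = normalize a * Polynomial.content f"
      using g content_mult[of g u] by (metis content_smult mult_1)
    then have "a dvd Polynomial.content u" by simp
    then obtain u' where "u = smult a u'"
      by (metis content_times_primitive_part dvdE smult_smult)
    ultimately have "smult a f = smult a (g * u')" by simp
    then show ?thesis using a by (metis dvdI smult_cancel)
  qed
  obtain k where k: "q = g * k" using dvd[of q] q z by auto
  have "degree g \<noteq> 0"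
  proof
    assume "degree g = 0"
    then obtain c where "g = [:c:]" by (metis degree_eq_zeroE)
    then show False using g by (auto simp: cpoly_simps)
  qed
  then have "degree k = 0"
    using two_power_cyclotomic_factor[of l g k] k q_def by auto
  then obtain c where c: "k = [:c:]" by (metis degree_eq_zeroE)
  have "q \<noteq> 0" using q[of 1] by auto
  then have "c \<noteq> 0" using c k by auto
  moreover have "poly (cpoly g) x * of_int c = 0"
    using q[of x] x unfolding k c by (auto simp: cpoly_simps)
  ultimately have "poly (cpoly g) x = 0" by simp
  then show ?thesis using dvd[OF p] by (auto simp: cpoly_simps elim!: dvdE)
qed auto

lemma Rats_common_denominator:
  fixes r :: "nat \<Rightarrow> real"
  assumes "\<And>i. i < m \<Longrightarrow> r i \<in> \<rat>"
  shows "\<exists>d::int. d \<noteq> 0 \<and> (\<forall>i<m. of_int d * r i \<in> \<int>)"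
  using assms
proof (induction m)
  case (Suc m)
  then obtain d :: int where d: "d \<noteq> 0" "\<And>i. i < m \<Longrightarrow> of_int d * r i \<in> \<int>" by auto
  have "r m \<in> \<rat>" using Suc.prems by simp
  then obtain a b :: int where ab: "b > 0" "r m = of_int a / of_int b"
    by (auto elim: Rats_cases')
  have "of_int (d * b) * r i \<in> \<int>" if "i < Suc m" for i
  proof (cases "i = m")
    case True
    then have "of_int (d * b) * r i = of_int (d * a)" using ab by simp
    then show ?thesis using Ints_of_int by metis
  next
    case False
    then have "of_int b * (of_int d * r i) \<in> \<int>" using that by (intro Ints_mult[OF Ints_of_int] d(2)) simp
    moreover have "of_int b * (of_int d * r i) = of_int (d * b) * r i" by simp
    ultimately show ?thesis by metis
  qed
  then show ?case using d ab by (intro exI[of _ "d * b"]) auto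
qed (auto intro: exI[of _ 1])

lemma two_power_cyclotomic_conjugate:
  fixes r :: "nat \<Rightarrow> real" and z x :: complex
  assumes r: "\<And>i. i < m \<Longrightarrow> r i \<in> \<rat>"
    and z: "z ^ (2 ^ l) = -1" and x: "x ^ (2 ^ l) = -1"
    and zero: "(\<Sum>i<m. of_real (r i) * z ^ i) = 0"
  shows "(\<Sum>i<m. of_real (r i) * x ^ i) = 0"
proof -
  obtain d :: int where d: "d \<noteq> 0" "\<And>i. i < m \<Longrightarrow> of_int d * r i \<in> \<int>"
    using Rats_common_denominator[of m r] r by auto
  \<comment> \<open>For i < m the number is already an integer; the floor merely names it as an
    \<open>int\<close>.\<close>
  define a where "a i = \<lfloor>of_int d * r i\<rfloor>" for i
  have a: "of_int (a i) = complex_of_int d * of_real (r i)" if "i < m" for i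
    using d(2)[OF that] unfolding a_def
    by (metis floor_of_int Ints_cases of_real_of_int_eq of_real_mult)
  define p where "p = (\<Sum>i<m. monom (a i) i)"
  have eval: "poly (cpoly p) w = of_int d * (\<Sum>i<m. of_real (r i) * w ^ i)" for w
  proof -
    have "cpoly p = (\<Sum>i<m. monom (of_int (a i)) i)"
      unfolding p_def by (intro poly_eqI) (simp add: coeff_map_poly coeff_sum of_int_sum if_distrib cong: if_cong)
    then show ?thesis
      by (simp add: poly_sum poly_monom a sum_distrib_left mult_ac)
  qed
  show ?thesis
    using two_power_cyclotomic_conjugate_int[OF z x, of p] zero d eval by simp
qed

section \<open>Discrete subgroups and rationality of traces\<close>

text \<open>Leaving out the spanning condition of \<open>complex_torus\<close> lets this property
  pass from \<open>periods A\<close> to the periods of a \<open>fixed_part\<close> by inclusion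
  alone.\<close>

definition discrete_subgroup :: "'a::real_normed_vector set \<Rightarrow> bool" where
  "discrete_subgroup L \<longleftrightarrow> 0 \<in> L \<and> (\<forall>u\<in>L. \<forall>v\<in>L. u - v \<in> L) \<and> discrete L"

lemma discrete_subgroup_add: "discrete_subgroup L \<Longrightarrow> u \<in> L \<Longrightarrow> v \<in> L \<Longrightarrow> u + v \<in> L"
  unfolding discrete_subgroup_def by (metis diff_0 diff_minus_eq_add)

lemma discrete_subgroup_scale:
  assumes L: "discrete_subgroup L" and u: "u \<in> L"
  shows "of_int k *\<^sub>R u \<in> L"
proof -
  have nat: "of_nat n *\<^sub>R u \<in> L" for n
  proof (induction n)
    case 0 show ?case using L by (simp add: discrete_subgroup_def)
  next
    case (Suc n) then show ?case using discrete_subgroup_add[OF L] u by (simp add: algebra_simps)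
  qed
  show ?thesis
  proof (cases "k \<ge> 0")
    case True then show ?thesis using nat[of "nat k"] by simp
  next
    case False
    then have "of_int k *\<^sub>R u = 0 - of_nat (nat (- k)) *\<^sub>R u" by simp
    then show ?thesis using nat L unfolding discrete_subgroup_def by metis
  qed
qed

lemma discrete_subgroup_sum:
  "discrete_subgroup L \<Longrightarrow> (\<And>i. i \<in> I \<Longrightarrow> f i \<in> L) \<Longrightarrow> sum f I \<in> L"
  by (induction I rule: infinite_finite_induct) (auto intro: discrete_subgroup_add simp: discrete_subgroup_def)

lemma discrete_subgroup_gap:
  assumes "discrete_subgroup L"
  shows "\<exists>\<epsilon>>0. \<forall>u\<in>L. norm u < \<epsilon> \<longrightarrow> u = 0"
proof -
  have "0 isolated_in L" using assms by (auto simp: discrete_subgroup_def discrete_def)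
  then obtain e where "e > 0" "\<forall>y\<in>L. dist 0 y < e \<longrightarrow> y = 0"
    by (auto simp: isolated_in_dist_Ex_iff)
  then show ?thesis by (auto simp: dist_norm)
qed

lemma discrete_subgroup_uniform_discrete:
  assumes "discrete_subgroup L"
  shows "uniform_discrete L"
proof -
  obtain e where e: "e > 0" "\<And>u. u \<in> L \<Longrightarrow> norm u < e \<Longrightarrow> u = 0"
    using discrete_subgroup_gap[OF assms] by auto
  have "x = y" if "x \<in> L" "y \<in> L" "dist x y < e" for x y
    using that e(2)[of "x - y"] assms by (auto simp: discrete_subgroup_def dist_norm)
  then show ?thesis using e(1) unfolding uniform_discrete_def by blast
qed

lemma discrete_subgroup_finite_bounded:
  fixes L :: "'a::euclidean_space set"
  assumes "discrete_subgroup L" "bounded S"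
  shows "finite (L \<inter> S)"
proof -
  have "uniform_discrete (L \<inter> S)"
    using discrete_subgroup_uniform_discrete[OF assms(1)] by (rule uniform_discrete_subset) simp
  then have "discrete (L \<inter> S)" "closed (L \<inter> S)"
    by (auto intro: uniform_discrete_imp_discrete uniform_discrete_imp_closed)
  moreover have "bounded (L \<inter> S)" using assms by auto
  ultimately show ?thesis
    using discrete_compact_finite_iff compact_eq_bounded_closed by blast
qed

text \<open>To be played off against the uncountably many real multiples of a vector, in the proof
  that an isogeny lifts to a surjective linear map.\<close>

lemma discrete_subgroup_countable:
  fixes L :: "'a::euclidean_space set"
  assumes "discrete_subgroup L"
  shows "countable L"
proof -
  have "L = (\<Union>n::nat. L \<inter> ball 0 (real n))"
    using reals_Archimedean2 by auto
  moreover have "countable \<dots>"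
    using discrete_subgroup_finite_bounded[OF assms] by (intro countable_UN) (auto intro: countable_finite)
  ultimately show ?thesis by metis
qed

text \<open>Among the multiples of \<open>v\<close>, reduced into the bounded fundamental box of \<open>B\<close>, two
  must coincide.\<close>

lemma discrete_subgroup_rational_coords:
  fixes L :: "'a::euclidean_space set"
  assumes L: "discrete_subgroup L" and B: "B \<subseteq> L" "independent B" "span B = UNIV" and v: "v \<in> L"
  shows "representation B v b \<in> \<rat>"
proof (cases "b \<in> B")
  case b: True
  have fin: "finite B" using B independent_imp_finite by blast
  let ?r = "representation B v"
  define red where "red k = of_nat k *\<^sub>R v - (\<Sum>b\<in>B. of_int \<lfloor>real k * ?r b\<rfloor> *\<^sub>R b)" for k :: nat
  have v_eq: "(\<Sum>b\<in>B. ?r b *\<^sub>R b) = v"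
    using B fin by (intro sum_representation_eq) auto
  have red_frac: "red k = (\<Sum>b\<in>B. frac (real k * ?r b) *\<^sub>R b)" for k
    unfolding red_def frac_def
    by (subst v_eq[symmetric]) (simp add: scaleR_sum_right sum_subtractf scaleR_diff_left)
  have red_L: "red k \<in> L" for k
  proof -
    have "real_of_int (int k) *\<^sub>R v \<in> L" "(\<Sum>b\<in>B. of_int \<lfloor>real k * ?r b\<rfloor> *\<^sub>R b) \<in> L"
      using L B v by (auto intro!: discrete_subgroup_sum discrete_subgroup_scale simp del: of_int_of_nat_eq)
    then show ?thesis using L unfolding red_def discrete_subgroup_def by simp
  qed
  have "norm (red k) \<le> (\<Sum>b\<in>B. norm b)" for k
    unfolding red_frac
    by (intro order_trans[OF norm_sum] sum_mono)
       (auto simp: frac_ge_0 frac_lt_1 less_imp_le intro!: mult_left_le_one_le)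
  then have "range red \<subseteq> L \<inter> cball 0 (\<Sum>b\<in>B. norm b)"
    using red_L by auto
  then have "finite (range red)"
    using discrete_subgroup_finite_bounded[OF L bounded_cball] finite_subset by blast
  then have "\<not> inj red" using finite_imageD infinite_UNIV_nat by blast
  then obtain k l where kl: "k \<noteq> l" "red k = red l" by (auto simp: inj_def)
  have "representation B (red m) b = frac (real m * ?r b)" for m
    unfolding red_frac using B b fin
    by (simp add: representation_sum representation_scale representation_basis if_distrib cong: if_cong)
  then have "frac (real k * ?r b) = frac (real l * ?r b)" using kl by metis
  then have "(real k - real l) * ?r b = of_int (\<lfloor>real k * ?r b\<rfloor> - \<lfloor>real l * ?r b\<rfloor>)"
    by (simp add: frac_def algebra_simps)
  then have "?r b = of_int (\<lfloor>real k * ?r b\<rfloor> - \<lfloor>real l * ?r b\<rfloor>) / (real k - real l)"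
    using kl by (simp add: field_simps)
  then show ?thesis by (metis Rats_divide Rats_diff Rats_of_int Rats_of_nat)
next
  case False
  then have "representation B v b = 0" using representation_ne_zero by blast
  then show ?thesis by simp
qed

text \<open>Each standard basis vector is expanded in B; after exchanging the sums, the inner
  products with the standard basis reassemble F b.\<close>

lemma trace_basis_independent:
  fixes F :: "'a::euclidean_space \<Rightarrow> 'a"
  assumes F: "linear F" and B: "independent B" "span B = UNIV"
  shows "(\<Sum>e\<in>Basis. F e \<bullet> e) = (\<Sum>b\<in>B. representation B (F b) b)"
proof -
  have fin: "finite B" using B independent_imp_finite by blast
  have "F e \<bullet> e = (\<Sum>b\<in>B. representation B e b * (F b \<bullet> e))" for e
  proof -
    have "F e = F (\<Sum>b\<in>B. representation B e b *\<^sub>R b)"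
      using B fin by (simp add: sum_representation_eq)
    also have "\<dots> = (\<Sum>b\<in>B. representation B e b *\<^sub>R F b)"
      using F by (simp add: linear_sum linear_cmul)
    finally show ?thesis by (simp add: inner_sum_left)
  qed
  then have "(\<Sum>e\<in>Basis. F e \<bullet> e) = (\<Sum>b\<in>B. \<Sum>e\<in>Basis. representation B e b * (F b \<bullet> e))"
    by (simp add: sum.swap[of _ Basis])
  also have "\<dots> = (\<Sum>b\<in>B. representation B (\<Sum>e\<in>Basis. (F b \<bullet> e) *\<^sub>R e) b)"
    using B by (simp add: representation_sum representation_scale mult.commute)
  finally show ?thesis by (simp add: euclidean_representation)
qed

text \<open>A maximal real-independent subset of L serves as basis. It need not generate L as a
  group, so the trace comes out rational instead of integral, which suffices.\<close>

lemma lattice_trace_rational: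
  fixes L :: "'a::euclidean_space set"
  assumes L: "discrete_subgroup L" "span L = UNIV" and F: "linear F" "F ` L \<subseteq> L"
  shows "(\<Sum>e\<in>Basis. F e \<bullet> e) \<in> \<rat>"
proof -
  obtain B where B: "B \<subseteq> L" "independent B" "L \<subseteq> span B"
    using maximal_independent_subset by blast
  have "span B = UNIV"
    using B(3) L(2) by (metis span_mono span_span top.extremum_uniqueI)
  moreover from this have "representation B (F b) b \<in> \<rat>" if "b \<in> B" for b
    using that B F(2) by (intro discrete_subgroup_rational_coords[OF L(1)]) auto
  ultimately show ?thesis
    using trace_basis_independent[OF F(1), of B] B(2) by (simp add: Rats_sum)
qed

section \<open>Complex traces\<close>

no_notation Matrix.vec_index (infixl "$" 100)

abbreviation clinear :: "(complex ^ 'm \<Rightarrow> complex ^ 'n) \<Rightarrow> bool" where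
  "clinear \<equiv> Vector_Spaces.linear (*s) (*s)"

definition ctrace :: "(complex ^ 'n \<Rightarrow> complex ^ 'n) \<Rightarrow> complex" where
  "ctrace F = (\<Sum>i\<in>UNIV. F (axis i 1) $ i)"

lemma ctrace_sum: "ctrace (\<lambda>v. \<Sum>k\<in>K. F k v) = (\<Sum>k\<in>K. ctrace (F k))"
  unfolding ctrace_def by (simp add: sum.swap[of _ UNIV])

lemma ctrace_basis_independent:
  assumes F: "clinear F" and B: "vec.independent B" "vec.span B = UNIV"
  shows "ctrace F = (\<Sum>b\<in>B. vec.representation B (F b) b)"
proof -
  interpret F: Vector_Spaces.linear "(*s)" "(*s)" F by (rule F)
  have fin: "finite B" using B vec.finiteI_independent by blast
  have "F e $ i = (\<Sum>b\<in>B. vec.representation B e b * F b $ i)" for e i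
  proof -
    have "F e = F (\<Sum>b\<in>B. vec.representation B e b *s b)"
      using B fin by (simp add: vec.sum_representation_eq)
    also have "\<dots> = (\<Sum>b\<in>B. vec.representation B e b *s F b)"
      by (simp add: F.sum F.scale)
    finally show ?thesis by simp
  qed
  then have "ctrace F = (\<Sum>b\<in>B. \<Sum>i\<in>UNIV. vec.representation B (axis i 1) b * F b $ i)"
    unfolding ctrace_def by (subst sum.swap) (rule sum.cong[OF HOL.refl])
  also have "\<dots> = (\<Sum>b\<in>B. vec.representation B (\<Sum>i\<in>UNIV. F b $ i *s axis i 1) b)"
    using B by (simp add: vec.representation_sum vec.representation_scale mult.commute)
  finally show ?thesis by (simp add: basis_expansion)
qed

text \<open>The bridge from \<open>rep_equiv\<close>, which speaks of matrices over a listed basis,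
  to the trace of the action.\<close>

lemma ctrace_matrix:
  assumes F: "clinear F"
    and es: "distinct es" "vec.independent (set es)" "vec.span (set es) = UNIV"
    and M: "\<And>k. k < length es \<Longrightarrow> F (es ! k) = (\<Sum>i<length es. M $$ (i, k) *s es ! i)"
  shows "ctrace F = (\<Sum>k<length es. M $$ (k, k))"
proof -
  have rep: "vec.representation (set es) (F (es ! k)) (es ! k) = M $$ (k, k)" if k: "k < length es" for k
  proof -
    have "vec.representation (set es) (F (es ! k)) (es ! k)
        = (\<Sum>i<length es. M $$ (i, k) * vec.representation (set es) (es ! i) (es ! k))"
      using es(2,3) k by (simp add: M vec.representation_sum vec.representation_scale)
    also have "\<dots> = (\<Sum>i<length es. if i = k then M $$ (i, k) else 0)"
      using es k
      by (intro sum.cong HOL.refl) (auto simp: vec.representation_basis nth_eq_iff_index_eq)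
    finally show ?thesis using k by simp
  qed
  have "ctrace F = (\<Sum>b\<in>set es. vec.representation (set es) (F b) b)"
    using F es by (intro ctrace_basis_independent) auto
  also have "\<dots> = (\<Sum>k<length es. vec.representation (set es) (F (es ! k)) (es ! k))"
    using es(1) by (intro sum.reindex_bij_betw[symmetric] bij_betw_nth) auto
  finally show ?thesis by (simp add: rep)
qed

text \<open>F acts on its range as the scalar c. In a basis extending one of the range, the diagonal
  entries are c on the range and 0 elsewhere.\<close>

lemma ctrace_multiple_of_projection:
  assumes F: "clinear F" and FF: "\<And>v. F (F v) = c *s F v" and c: "c \<noteq> 0"
  shows "ctrace F = c * of_nat (vec.dim (range F))"
proof -
  interpret F: Vector_Spaces.linear "(*s)" "(*s)" F by (rule F)
  have R: "vec.subspace (range F)" using F.subspace_image vec.subspace_UNIV by blast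
  obtain S where S: "S \<subseteq> range F" "vec.independent S" "range F \<subseteq> vec.span S" "card S = vec.dim (range F)"
    using vec.basis_exists by blast
  have span_S: "vec.span S = range F"
    using S R by (simp add: vec.span_subspace)
  obtain B where B: "S \<subseteq> B" "vec.independent B" "vec.span B = UNIV"
    using vec.maximal_independent_subset_extend[OF subset_UNIV S(2)] by (metis top.extremum_uniqueI)
  have fin: "finite B" using B vec.finiteI_independent by blast
  have rep: "vec.representation B (F b) b = (if b \<in> S then c else 0)" if b: "b \<in> B" for b
  proof (cases "b \<in> S")
    case True
    then obtain v where "b = F v" using S by auto
    then have "F b = c *s b" using FF by simp
    then show ?thesis using True B b by (simp add: vec.representation_scale vec.representation_basis)
  next
    case False
    \<comment> \<open>\<open>F b\<close> lies in the span of \<open>S\<close>, so it has no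
      component along \<open>b\<close>.\<close>
    have "vec.representation B (F b) = vec.representation S (F b)"
      using B span_S by (intro vec.representation_extend) auto
    then show ?thesis using False vec.representation_ne_zero by metis
  qed
  have "ctrace F = (\<Sum>b\<in>B. if b \<in> S then c else 0)"
    using F B rep by (simp add: ctrace_basis_independent)
  also have "\<dots> = c * of_nat (card S)"
    using fin B(1) by (simp add: sum.If_cases Int_absorb1 mult.commute)
  finally show ?thesis using S by simp
qed

text \<open>Multiplication by a complex number z is a real linear map of the plane with trace 2 Re
  z; the real basis pairs \<open>axis i 1\<close> with \<open>axis i \<i>\<close>.\<close>

lemma real_trace_eq_ctrace:
  assumes F: "clinear F"
  shows "(\<Sum>e\<in>Basis. F e \<bullet> e) = 2 * Re (ctrace (F :: complex ^ 'n \<Rightarrow> complex ^ 'n))"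
proof -
  interpret F: Vector_Spaces.linear "(*s)" "(*s)" F by (rule F)
  have ax: "axis i u = u *s axis i (1 :: complex)" for i :: 'n and u
    by (simp add: Finite_Cartesian_Product.vec_eq_iff axis_def)
  have "F (axis i u) \<bullet> axis i u = Re (F (axis i 1) $ i)" if "u \<in> {1, \<i>}" for i u
    using that by (subst (1) ax) (auto simp: F.scale inner_axis inner_complex_def)
  then have "(\<Sum>u\<in>Basis. F (axis i u) \<bullet> axis i u) = 2 * Re (F (axis i 1) $ i)" for i
    by (simp add: Basis_complex_def complex_eq_iff)
  moreover have "(\<Sum>e\<in>Basis. F e \<bullet> e) = (\<Sum>i\<in>UNIV. \<Sum>u\<in>Basis. F (axis i u) \<bullet> axis i u)"
    unfolding Basis_vec_def
    by (subst sum.UNION_disjoint) (auto simp: axis_eq_axis sum.UNION_disjoint)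
  ultimately show ?thesis by (simp add: ctrace_def sum_distrib_left)
qed

section \<open>Isogenies and dimension\<close>

lemma scaleR_eq_scale: "r *\<^sub>R v = of_real r *s (v :: complex ^ 'n)"
  by (simp add: Finite_Cartesian_Product.vec_eq_iff) (simp add: scaleR_conv_of_real)

lemma clinear_imp_linear: "clinear F \<Longrightarrow> linear F"
proof -
  assume "clinear F"
  then interpret F: Vector_Spaces.linear "(*s)" "(*s)" F .
  show "linear F"
    by (intro linearI) (simp_all add: F.add F.scale scaleR_eq_scale)
qed

lemma vec_dim_product:
  fixes S :: "(complex ^ 'm) set" and T :: "(complex ^ 'n) set"
  assumes S: "vec.subspace S" and T: "vec.subspace T"
  shows "vec.dim {v :: complex ^ ('m + 'n). (\<chi> i. v $ Inl i) \<in> S \<and> (\<chi> j. v $ Inr j) \<in> T}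
    = vec.dim S + vec.dim T"
proof -
  define l :: "complex ^ 'm \<Rightarrow> complex ^ ('m + 'n)"
    where "l u = (\<chi> i. case i of Inl i \<Rightarrow> u $ i | Inr j \<Rightarrow> 0)" for u
  define r :: "complex ^ 'n \<Rightarrow> complex ^ ('m + 'n)"
    where "r u = (\<chi> i. case i of Inl i \<Rightarrow> 0 | Inr j \<Rightarrow> u $ j)" for u
  have l: "clinear l" and r: "clinear r"
    unfolding l_def r_def
    by (unfold_locales; simp add: Finite_Cartesian_Product.vec_eq_iff split: sum.split)+
  interpret l: Vector_Spaces.linear "(*s)" "(*s)" l by (rule l)
  interpret r: Vector_Spaces.linear "(*s)" "(*s)" r by (rule r)
  have nth [simp]: "l u $ Inl i = u $ i" "l u $ Inr j = 0" "r w $ Inl i = 0" "r w $ Inr j = w $ j" for u w i j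
    by (simp_all add: l_def r_def)
  have "inj l" "inj r"
    by (auto intro!: injI simp: Finite_Cartesian_Product.vec_eq_iff dest!: fun_cong) (metis nth(1), metis nth(4))
  have "{v. (\<chi> i. v $ Inl i) \<in> S \<and> (\<chi> j. v $ Inr j) \<in> T} = {x + y |x y. x \<in> l ` S \<and> y \<in> r ` T}"
    (is "?P = ?Q")
  proof (intro equalityI subsetI)
    fix v assume "v \<in> ?P"
    moreover have "v = l (\<chi> i. v $ Inl i) + r (\<chi> j. v $ Inr j)"
      by (simp add: Finite_Cartesian_Product.vec_eq_iff l_def r_def split: sum.split)
    ultimately show "v \<in> ?Q" by blast
  qed auto
  moreover have "l ` S \<inter> r ` T = {0}"
  proof (intro equalityI subsetI)
    fix v assume "v \<in> l ` S \<inter> r ` T"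
    then obtain x y where v: "v = l x" "v = r y" by blast
    have "v $ i = 0" for i
      by (cases i) (metis v nth)+
    then show "v \<in> {0}" by (simp add: Finite_Cartesian_Product.vec_eq_iff)
  next
    fix v :: "complex ^ ('m + 'n)" assume "v \<in> {0}"
    moreover have "l 0 = 0" "r 0 = 0"
      by (simp_all add: Finite_Cartesian_Product.vec_eq_iff l_def r_def split: sum.split)
    ultimately show "v \<in> l ` S \<inter> r ` T"
      using vec.subspace_0[OF S] vec.subspace_0[OF T] by (auto intro: rev_image_eqI)
  qed
  moreover have "vec.dim (l ` S) = vec.dim S" "vec.dim (r ` T) = vec.dim T"
    using l r \<open>inj l\<close> \<open>inj r\<close> by (auto intro!: vec.dim_image_eq intro: inj_on_subset)
  moreover have "vec.subspace (l ` S)" "vec.subspace (r ` T)"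
    by (rule l.subspace_image[OF S] r.subspace_image[OF T])+
  ultimately show ?thesis
    using vec.dim_sums_Int[of "l ` S" "r ` T"] by simp
qed

section \<open>Isogenies and their lifts to tangent spaces\<close>

lemma torus_proj_eq_iff:
  assumes "discrete_subgroup (periods T)"
  shows "torus_proj T u = torus_proj T v \<longleftrightarrow> u - v \<in> periods T"
proof
  assume "torus_proj T u = torus_proj T v"
  moreover have "u \<in> torus_proj T u"
    using assms by (auto simp: torus_proj_def discrete_subgroup_def intro!: image_eqI[of _ _ 0])
  ultimately show "u - v \<in> periods T" by (auto simp: torus_proj_def)
next
  assume uv: "u - v \<in> periods T"
  have "u + w \<in> (+) v ` periods T" if "w \<in> periods T" for w
    using discrete_subgroup_add[OF assms uv that] by (intro image_eqI[of _ _ "u - v + w"]) auto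
  moreover have "v + w \<in> (+) u ` periods T" if "w \<in> periods T" for w
    using assms uv that unfolding discrete_subgroup_def
    by (intro image_eqI[of _ _ "w - (u - v)"]) auto
  ultimately show "torus_proj T u = torus_proj T v" unfolding torus_proj_def by auto
qed

lemma torus_proj_zero: "torus_proj T 0 = periods T"
  by (auto simp: torus_proj_def)

text \<open>The linear lift F is a bijection of tangent spaces. The finite kernel excludes null
  vectors. Surjectivity on points gives surjectivity only modulo periods, which a cardinality
  argument improves.\<close>

lemma isogeny_dim_eq:
  fixes S :: "'m::finite torus" and T :: "'n::finite torus"
  assumes iso: "isogenous S T"
    and S: "vec.subspace (tangent S)" "discrete_subgroup (periods S)"
    and T: "vec.subspace (tangent T)" "discrete_subgroup (periods T)"
  shows "torus_dim S = torus_dim T"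
proof -
  obtain f where isog: "isogeny S T f" using iso unfolding isogenous_def ..
  then have surj: "f ` torus_points S = torus_points T"
    and ker: "finite {p \<in> torus_points S. f p = periods T}"
    and hom: "torus_hom S T f"
    unfolding isogeny_def by auto
  obtain F where F: "clinear F" "F ` tangent S \<subseteq> tangent T" "F ` periods S \<subseteq> periods T"
    and "\<forall>v\<in>tangent S. f (torus_proj S v) = torus_proj T (F v)"
    using hom unfolding torus_hom_def by (elim exE conjE)
  then have f: "f (torus_proj S v) = torus_proj T (F v)" if "v \<in> tangent S" for v
    using that by blast
  interpret F: Vector_Spaces.linear "(*s)" "(*s)" F by (rule F)
  have "inj_on F (tangent S)"
  proof (rule inj_onI)
    fix u v assume uv: "u \<in> tangent S" "v \<in> tangent S" "F u = F v"
    define w where "w = u - v"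
    have w: "w \<in> tangent S" "F w = 0"
      using uv S(1) by (auto simp: w_def vec.subspace_diff F.diff)
    show "u = v"
    proof (rule ccontr)
      assume "u \<noteq> v"
      then have w0: "w \<noteq> 0" by (simp add: w_def)
      obtain e where e: "e > 0" "\<And>x. x \<in> periods S \<Longrightarrow> norm x < e \<Longrightarrow> x = 0"
        using discrete_subgroup_gap[OF S(2)] by auto
      \<comment> \<open>Positive multiples of the null vector \<open>w\<close> shorter than the gap
        \<open>e\<close> represent pairwise distinct points of the kernel, which would then be
        infinite.\<close>
      let ?g = "\<lambda>r::real. torus_proj S (r *\<^sub>R w)"
      have rw: "r *\<^sub>R w \<in> tangent S" "F (r *\<^sub>R w) = 0" for r
        using w S(1) by (auto simp: scaleR_eq_scale vec.subspace_scale F.scale)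
      have "?g ` {0<..<e / norm w} \<subseteq> {p \<in> torus_points S. f p = periods T}"
        using rw by (auto simp: torus_points_def f torus_proj_zero)
      then have "finite (?g ` {0<..<e / norm w})"
        using ker finite_subset by blast
      moreover have "inj_on ?g {0<..<e / norm w}"
      proof (rule inj_onI)
        fix r s assume rs: "r \<in> {0<..<e / norm w}" "s \<in> {0<..<e / norm w}" "?g r = ?g s"
        then have "r *\<^sub>R w - s *\<^sub>R w \<in> periods S"
          by (simp add: torus_proj_eq_iff[OF S(2)])
        then have "(r - s) *\<^sub>R w \<in> periods S" by (simp add: scaleR_diff_left)
        moreover have "\<bar>r - s\<bar> < e / norm w" using rs by auto
        then have "norm ((r - s) *\<^sub>R w) < e"
          using w0 unfolding norm_scaleR by (simp add: pos_less_divide_eq)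
        ultimately have "(r - s) *\<^sub>R w = 0" using e(2) by blast
        then show "r = s" using w0 unfolding scaleR_eq_0_iff by simp
      qed
      ultimately have "finite {0<..<e / norm w}" by (rule finite_imageD)
      then show False using e(1) w0 by (simp add: infinite_Ioo)
    qed
  qed
  moreover have "F ` tangent S = tangent T"
  proof (intro equalityI F(2) subsetI, rule ccontr)
    fix v assume v: "v \<in> tangent T" "v \<notin> F ` tangent S"
    have "\<exists>u\<in>tangent S. r *\<^sub>R v - F u \<in> periods T" for r
    proof -
      have "r *\<^sub>R v \<in> tangent T" using v T(1) by (simp add: scaleR_eq_scale vec.subspace_scale)
      then have "torus_proj T (r *\<^sub>R v) \<in> f ` torus_points S"
        unfolding surj by (simp add: torus_points_def)
      then obtain u where "u \<in> tangent S" "torus_proj T (r *\<^sub>R v) = torus_proj T (F u)"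
        by (auto simp: torus_points_def f)
      then show ?thesis using torus_proj_eq_iff[OF T(2)] by blast
    qed
    then obtain u where u: "\<And>r. u r \<in> tangent S" "\<And>r. r *\<^sub>R v - F (u r) \<in> periods T" by metis
    \<comment> \<open>There are uncountably many r but countably many periods. Two values of r
      sharing a period exhibit a nonzero multiple of \<open>v\<close> as an image under F.\<close>
    have "\<not> inj (\<lambda>r. r *\<^sub>R v - F (u r))"
    proof
      assume "inj (\<lambda>r. r *\<^sub>R v - F (u r))"
      moreover have "countable (range (\<lambda>r. r *\<^sub>R v - F (u r)))"
        using discrete_subgroup_countable[OF T(2)] u(2) by (auto intro: countable_subset)
      ultimately have "countable (UNIV :: real set)" using countable_image_inj_eq by blast
      then show False using uncountable_UNIV_real by blast
    qed
    then obtain r s where rs: "r \<noteq> s" "r *\<^sub>R v - F (u r) = s *\<^sub>R v - F (u s)"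
      by (auto simp: inj_def)
    have Fu: "F (u r - u s) = (r - s) *\<^sub>R v"
    proof -
      have "F (u r) - F (u s) = r *\<^sub>R v - s *\<^sub>R v"
        using rs(2) by (metis add_diff_cancel_left diff_add_cancel diff_add_eq_diff_diff_swap)
      then show ?thesis by (simp only: F.diff scaleR_diff_left)
    qed
    have "F ((1 / (r - s)) *\<^sub>R (u r - u s)) = (1 / (r - s)) *\<^sub>R ((r - s) *\<^sub>R v)"
      unfolding linear_cmul[OF clinear_imp_linear[OF F(1)]] Fu ..
    also have "\<dots> = v" using rs(1) unfolding scaleR_scaleR by simp
    finally have "v = F ((1 / (r - s)) *\<^sub>R (u r - u s))" by (rule HOL.sym)
    moreover have "(1 / (r - s)) *\<^sub>R (u r - u s) \<in> tangent S"
      using u(1) S(1) by (simp add: scaleR_eq_scale vec.subspace_scale vec.subspace_diff)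
    ultimately show False using v(2) by blast
  qed
  ultimately show ?thesis
    using vec.dim_image_eq[OF F(1), of "tangent S"]
    unfolding torus_dim_def vec.span_eq_iff[THEN iffD2, OF S(1)] by simp
qed

lemma discrete_subgroupI:
  assumes "0 \<in> L" "\<And>u v. u \<in> L \<Longrightarrow> v \<in> L \<Longrightarrow> u - v \<in> L"
    and e: "\<epsilon> > 0" "\<And>u. u \<in> L \<Longrightarrow> norm u < \<epsilon> \<Longrightarrow> u = 0"
  shows "discrete_subgroup L"
proof -
  have "x = y" if "x \<in> L" "y \<in> L" "dist x y < \<epsilon>" for x y
    using assms(2)[OF that(1,2)] e(2)[of "x - y"] that(3) by (simp add: dist_norm)
  then have "uniform_discrete L" using e(1) unfolding uniform_discrete_def by blast
  then show ?thesis
    using assms unfolding discrete_subgroup_def by (blast intro: uniform_discrete_imp_discrete)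
qed

lemma subspace_torus_prod:
  fixes S :: "'m::finite torus" and T :: "'n::finite torus"
  assumes S: "vec.subspace (tangent S)" and T: "vec.subspace (tangent T)"
  shows "vec.subspace (tangent (torus_prod S T))"
proof -
  let ?l = "\<lambda>v :: complex ^ ('m + 'n). \<chi> i. v $ Inl i" and ?r = "\<lambda>v :: complex ^ ('m + 'n). \<chi> j. v $ Inr j"
  have "?l 0 = 0" "?r 0 = 0" "?l (u + v) = ?l u + ?l v" "?r (u + v) = ?r u + ?r v"
    "?l (c *s u) = c *s ?l u" "?r (c *s u) = c *s ?r u" for u v c
    by (simp_all add: Finite_Cartesian_Product.vec_eq_iff)
  then show ?thesis
    using S T by (simp add: torus_prod_def vec.subspace_def)
qed

text \<open>The squared norm splits over the two factors, so the smaller of the two gaps is a gap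
  for the product.\<close>

lemma discrete_subgroup_torus_prod:
  fixes S :: "'m::finite torus" and T :: "'n::finite torus"
  assumes S: "discrete_subgroup (periods S)" and T: "discrete_subgroup (periods T)"
  shows "discrete_subgroup (periods (torus_prod S T))"
proof -
  obtain d where d: "d > 0" "\<And>u. u \<in> periods S \<Longrightarrow> norm u < d \<Longrightarrow> u = 0"
    using discrete_subgroup_gap[OF S] by auto
  obtain e where e: "e > 0" "\<And>u. u \<in> periods T \<Longrightarrow> norm u < e \<Longrightarrow> u = 0"
    using discrete_subgroup_gap[OF T] by auto
  let ?l = "\<lambda>v :: complex ^ ('m + 'n). \<chi> i. v $ Inl i" and ?r = "\<lambda>v :: complex ^ ('m + 'n). \<chi> j. v $ Inr j"
  have norm_sq: "(norm v)\<^sup>2 = (norm (?l v))\<^sup>2 + (norm (?r v))\<^sup>2" for v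
    using sum.Plus[of UNIV UNIV "\<lambda>i. (norm (v $ i))\<^sup>2"]
    by (simp add: norm_vec_def L2_set_def sum_nonneg)
  have le: "norm (?l v) \<le> norm v" "norm (?r v) \<le> norm v" for v
    by (rule power2_le_imp_le; simp add: norm_sq)+
  show ?thesis
  proof (rule discrete_subgroupI[of _ "min d e"])
    fix v assume v: "v \<in> periods (torus_prod S T)" "norm v < min d e"
    then have "?l v = 0" "?r v = 0"
      using d(2)[of "?l v"] e(2)[of "?r v"] le[of v] by (auto simp: torus_prod_def)
    then have "(norm v)\<^sup>2 = 0" using norm_sq[of v] by simp
    then show "v = 0" by simp
  next
    have "?l (u - v) = ?l u - ?l v" "?r (u - v) = ?r u - ?r v" for u v
      by (simp_all add: Finite_Cartesian_Product.vec_eq_iff)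
    then show "u - v \<in> periods (torus_prod S T)"
      if "u \<in> periods (torus_prod S T)" "v \<in> periods (torus_prod S T)" for u v
      using that S T by (simp add: torus_prod_def discrete_subgroup_def)
  next
    have "?l 0 = 0" "?r 0 = 0"
      by (simp_all add: Finite_Cartesian_Product.vec_eq_iff)
    then show "0 \<in> periods (torus_prod S T)"
      using S T by (simp add: torus_prod_def discrete_subgroup_def)
  qed (use d e in auto)
qed

text \<open>\<open>is_prym\<close> does not single out one P, but the isogeny to the product
  determines its dimension.\<close>

lemma prym_dim:
  assumes P: "is_prym B C P"
    and B: "vec.subspace (tangent B)" "discrete_subgroup (periods B)"
    and C: "vec.subspace (tangent C)" "discrete_subgroup (periods C)"
  shows "torus_dim B = torus_dim P + torus_dim C"
proof -
  have P': "vec.subspace (tangent P)" "discrete_subgroup (periods P)"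
    using P unfolding is_prym_def abelian_subvariety_def complex_torus_def discrete_subgroup_def by auto
  let ?T = "torus_prod P C"
  have "vec.subspace (tangent ?T)"
    using P'(1) C(1) by (rule subspace_torus_prod)
  moreover have "discrete_subgroup (periods ?T)"
    using P'(2) C(2) by (rule discrete_subgroup_torus_prod)
  moreover have "isogenous B ?T" using P by (simp add: is_prym_def)
  ultimately have "torus_dim B = torus_dim ?T" using B by (intro isogeny_dim_eq)
  also have "\<dots> = torus_dim P + torus_dim C"
    using P' C by (simp add: torus_dim_def torus_prod_def vec_dim_product)
  finally show ?thesis .
qed

section \<open>Presented groups and the subgroups of quaternion groups\<close>

lemma word_class_eq_iff: "word_class R u = word_class R v \<longleftrightarrow> word_eq R u v"
  unfolding word_class_def by (auto intro: word_eq.refl word_eq.sym word_eq.trans)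

lemma word_class_mult:
  "word_class R u \<otimes>\<^bsub>presented_group R\<^esub> word_class R v = word_class R (u @ v)"
  unfolding word_class_def presented_group_def
  by (auto intro: word_eq.refl word_eq.sym word_eq.trans word_eq.append)

lemma word_class_one: "\<one>\<^bsub>presented_group R\<^esub> = word_class R []"
  by (simp add: presented_group_def)

lemma word_class_carrier: "word_class R u \<in> carrier (presented_group R)"
  by (simp add: presented_group_def)

lemma presented_group_cases:
  assumes "C \<in> carrier (presented_group R)"
  obtains u where "C = word_class R u"
  using assms by (auto simp: presented_group_def)

definition inv_word :: "'a word \<Rightarrow> 'a word" where
  "inv_word w = rev (map (\<lambda>(a, b). (a, \<not> b)) w)"

lemma word_eq_inv_word: "word_eq R (inv_word w @ w) []"
proof (induction w)
  case (Cons l w)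
  obtain a b where l: "l = (a, b)" by fastforce
  have "word_eq R ([(a, \<not> b), (a, \<not> \<not> b)] @ w) ([] @ w)"
    by (intro word_eq.append word_eq.cancel word_eq.refl)
  then have "word_eq R (inv_word w @ ([(a, \<not> b), (a, b)] @ w)) (inv_word w @ w)"
    by (intro word_eq.append word_eq.refl) simp
  then show ?case using Cons.IH by (auto simp: l inv_word_def intro: word_eq.trans)
qed (simp add: inv_word_def word_eq.refl)

lemma group_presented_group: "group (presented_group R)"
proof (rule groupI)
  fix C assume "C \<in> carrier (presented_group R)"
  then obtain u where "C = word_class R u" by (rule presented_group_cases)
  then show "\<exists>D\<in>carrier (presented_group R). D \<otimes>\<^bsub>presented_group R\<^esub> C = \<one>\<^bsub>presented_group R\<^esub>"
    using word_eq_inv_word[of R u]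
    by (intro bexI[of _ "word_class R (inv_word u)"])
       (simp_all add: word_class_mult word_class_one word_class_eq_iff word_class_carrier)
qed (auto elim!: presented_group_cases simp: word_class_mult word_class_one word_class_carrier)

lemma word_eval_simps [simp]:
  "word_eval M f [] = \<one>\<^bsub>M\<^esub>"
  "word_eval M f ((a, b) # w) = (if b then f a else inv\<^bsub>M\<^esub> (f a)) \<otimes>\<^bsub>M\<^esub> word_eval M f w"
  by (simp_all add: word_eval_def)

lemma word_eval_closed:
  assumes "monoid M" "\<And>a. f a \<in> Units M"
  shows "word_eval M f w \<in> carrier M"
proof -
  interpret monoid M by fact
  show ?thesis
    by (induction w) (auto simp: assms(2) Units_closed)
qed

lemma word_eval_append:
  assumes "monoid M" "\<And>a. f a \<in> Units M"
  shows "word_eval M f (u @ v) = word_eval M f u \<otimes>\<^bsub>M\<^esub> word_eval M f v"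
proof -
  interpret monoid M by fact
  have "word_eval M f w \<in> carrier M" for w
    by (rule word_eval_closed) fact+
  then show ?thesis
    by (induction u) (auto simp: assms(2) Units_closed m_assoc)
qed

text \<open>The universal property of a presentation (von Dyck), by induction over the derivation of
  the equality of words.\<close>

lemma word_eval_cong:
  assumes M: "monoid M" and f: "\<And>a. f a \<in> Units M"
    and R: "\<And>r. r \<in> R \<Longrightarrow> word_eval M f r = \<one>\<^bsub>M\<^esub>"
    and uv: "word_eq R u v"
  shows "word_eval M f u = word_eval M f v"
  using uv
proof induction
  case (append u u' v v')
  then show ?case using M f by (simp add: word_eval_append)
next
  case (cancel a b)
  interpret monoid M by (rule M)
  show ?case using f by (cases b) (simp_all add: Units_closed)
next
  case (relator r)
  then show ?case using R by simp
qed simp_all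

lemma presented_hom_word_class:
  assumes "monoid M" "\<And>a. f a \<in> Units M" "\<And>r. r \<in> R \<Longrightarrow> word_eval M f r = \<one>\<^bsub>M\<^esub>"
  shows "presented_hom M f (word_class R w) = word_eval M f w"
proof -
  have "word_eval M f ` word_class R w = {word_eval M f w}"
    using word_eval_cong[of M f R] assms by (auto simp: word_class_def intro: word_eq.refl)
  then show ?thesis by (simp add: presented_hom_def)
qed

section \<open>Normal forms x^i and x^i y, and the subgroups built from them\<close>

locale quaternion_relations = group G for G (structure) +
  fixes x y and M :: nat
  assumes x: "x \<in> carrier G" and y: "y \<in> carrier G" and M: "M > 0"
    and x_order: "x [^] (2 * M) = \<one>"
    and yyx: "(y \<otimes> y) \<otimes> x [^] M = \<one>"
    and yxyx: "y \<otimes> x \<otimes> inv y \<otimes> x = \<one>"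
begin

lemma x_pow [simp]: "x [^] (i :: nat) \<in> carrier G"
  using x by simp

lemma x_periodic: "x [^] (2 * M * k + i) = x [^] (i :: nat)"
proof -
  have "x [^] (2 * M * k) = \<one>"
    using x x_order by (simp flip: nat_pow_pow)
  then show ?thesis using x by (simp flip: nat_pow_mult)
qed

lemma x_pow_mod: "x [^] i = x [^] (i mod (2 * M))"
  using x_periodic[of "i div (2 * M)" "i mod (2 * M)"] by (simp add: mult.commute)

lemma yy: "y \<otimes> y = x [^] M"
proof -
  have "x [^] M \<otimes> x [^] M = \<one>"
    using x x_order by (simp add: nat_pow_mult mult_2)
  then have "inv (x [^] M) = x [^] M" by (simp add: inv_equality)
  then show ?thesis using yyx inv_equality[of "y \<otimes> y" "x [^] M"] y by simp
qed

text \<open>The power with exponent 2M - 1 stands for the inverse of x, which keeps all exponents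
  natural.\<close>

lemma yx: "y \<otimes> x = x [^] (2 * M - 1) \<otimes> y"
proof -
  have "x [^] (2 * M - 1) \<otimes> x = \<one>"
    using x_order M x by (metis Suc_diff_1 nat_0_less_mult_iff nat_pow_Suc zero_less_numeral)
  then have "inv x = x [^] (2 * M - 1)" using x by (simp add: inv_equality)
  moreover have "y \<otimes> x \<otimes> inv y = inv x"
    using yxyx x y by (metis inv_closed inv_equality m_closed)
  then have "y \<otimes> x = inv x \<otimes> y"
    using x y by (metis inv_closed inv_solve_right' m_closed)
  ultimately show ?thesis by simp
qed

lemma y_x_pow: "y \<otimes> x [^] k = x [^] ((2 * M - 1) * k) \<otimes> y"
proof (induction k)
  case (Suc k)
  have "y \<otimes> x [^] Suc k = (y \<otimes> x [^] k) \<otimes> x"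
    using x y by (simp add: m_assoc)
  also have "\<dots> = x [^] ((2 * M - 1) * k) \<otimes> (y \<otimes> x)"
    using x y Suc by (simp add: m_assoc)
  also have "\<dots> = x [^] ((2 * M - 1) * k + (2 * M - 1)) \<otimes> y"
    using x y by (simp add: yx m_assoc flip: nat_pow_mult)
  finally show ?case by (simp add: add.commute)
qed (use y in simp)

text \<open>The multiplication table of the normal forms. Moving x^j leftwards past y inverts it,
  hence the factor 2M - 1; the final M comes from y y = x^M.\<close>

lemma mult_simps:
  "x [^] i \<otimes> x [^] j = x [^] (i + j)"
  "x [^] i \<otimes> (x [^] j \<otimes> y) = x [^] (i + j) \<otimes> y"
  "(x [^] i \<otimes> y) \<otimes> x [^] j = x [^] (i + (2 * M - 1) * j) \<otimes> y"
  "(x [^] i \<otimes> y) \<otimes> (x [^] j \<otimes> y) = x [^] (i + (2 * M - 1) * j + M)"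
proof -
  show *: "x [^] i \<otimes> x [^] j = x [^] (i + j)" for i j :: nat
    using x by (simp add: nat_pow_mult)
  then show "x [^] i \<otimes> (x [^] j \<otimes> y) = x [^] (i + j) \<otimes> y"
    using y by (simp flip: m_assoc)
  show **: "(x [^] i \<otimes> y) \<otimes> x [^] j = x [^] (i + (2 * M - 1) * j) \<otimes> y" for i j
  proof -
    have "(x [^] i \<otimes> y) \<otimes> x [^] j = x [^] i \<otimes> (y \<otimes> x [^] j)"
      using y by (simp add: m_assoc)
    also have "\<dots> = (x [^] i \<otimes> x [^] ((2 * M - 1) * j)) \<otimes> y"
      using y by (simp add: y_x_pow m_assoc)
    finally show ?thesis by (simp add: *)
  qed
  have "(x [^] i \<otimes> y) \<otimes> (x [^] j \<otimes> y) = (x [^] i \<otimes> y \<otimes> x [^] j) \<otimes> y"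
    using y by (simp add: m_assoc)
  also have "\<dots> = x [^] (i + (2 * M - 1) * j) \<otimes> (y \<otimes> y)"
    unfolding ** using y by (simp add: m_assoc)
  finally show "(x [^] i \<otimes> y) \<otimes> (x [^] j \<otimes> y) = x [^] (i + (2 * M - 1) * j + M)"
    by (simp add: yy *)
qed

definition cyc :: "nat \<Rightarrow> 'a set" where
  "cyc d = range (\<lambda>i. x [^] (d * i))"

text \<open>Together with \<open>cyc d\<close> this will be H_j for d = 2^(n-j) and c = 0, its
  twisted companion for c = 1, and the whole group for d = 1 and c = 0.\<close>

definition coset_y :: "nat \<Rightarrow> nat \<Rightarrow> 'a set" where
  "coset_y d c = range (\<lambda>i. x [^] (d * i + c) \<otimes> y)"

lemma cycI: "d dvd i \<Longrightarrow> x [^] i \<in> cyc d"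
  by (auto simp: cyc_def elim: dvdE)

text \<open>As d divides 2M, the second condition says that i and c agree modulo d. This form avoids
  subtraction of natural numbers.\<close>

lemma coset_yI: "d dvd 2 * M \<Longrightarrow> d dvd i + (2 * M - 1) * c \<Longrightarrow> x [^] i \<otimes> y \<in> coset_y d c"
proof -
  assume "d dvd 2 * M" "d dvd i + (2 * M - 1) * c"
  then obtain k where k: "i + (2 * M - 1) * c = d * k" by (auto elim: dvdE)
  have "2 * M * c + i = d * k + c"
    using M by (simp flip: k) (simp add: algebra_simps)
  then have "x [^] i = x [^] (d * k + c)" using x_periodic[of c i] by simp
  then show ?thesis unfolding coset_y_def by auto
qed

lemma subgroup_cyc: "subgroup (cyc d) G"
proof (rule subgroupI)
  fix a assume "a \<in> cyc d"
  then obtain i where a: "a = x [^] (d * i)" by (auto simp: cyc_def)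
  have "x [^] ((2 * M - 1) * (d * i)) \<otimes> a = x [^] (2 * M * (d * i) + 0)"
    unfolding a mult_simps using M by (simp add: algebra_simps)
  then have "inv a = x [^] ((2 * M - 1) * (d * i))"
    unfolding x_periodic using a by (intro inv_equality) auto
  then show "inv a \<in> cyc d" by (auto intro: cycI)
qed (auto simp: cyc_def mult_simps add_mult_distrib2[symmetric])

text \<open>Every element of the coset has square x^M, which lies in \<open>cyc d\<close> because d
  divides M.\<close>

lemma subgroup_dicyclic:
  assumes d: "d dvd M"
  shows "subgroup (cyc d \<union> coset_y d c) G"
proof (rule subgroupI)
  have d2: "d dvd 2 * M" using d by simp
  show "cyc d \<union> coset_y d c \<subseteq> carrier G" "cyc d \<union> coset_y d c \<noteq> {}"
    using y by (auto simp: cyc_def coset_y_def)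
  \<comment> \<open>Turns the divisibility condition of \<open>coset_yI\<close> into one with the
    summand \<open>2 * M * c\<close>, a multiple of d.\<close>
  have red: "2 * M * c = (2 * M - 1) * c + c" using M by (simp add: algebra_simps)
  {
    fix a assume "a \<in> cyc d \<union> coset_y d c"
    then consider (cyc) "a \<in> cyc d" | (cs) i where "a = x [^] (d * i + c) \<otimes> y"
      by (auto simp: coset_y_def)
    then show "inv a \<in> cyc d \<union> coset_y d c"
    proof cases
      case cyc
      then show ?thesis using subgroup.m_inv_closed[OF subgroup_cyc] by blast
    next
      case cs
      \<comment> \<open>The square of x^j y is x^M, and the square of x^M is 1; hence x^(M+j) y is
        the inverse of x^j y.\<close>
      have "(x [^] (M + (d * i + c)) \<otimes> y) \<otimes> a = x [^] (2 * M * (d * i + c + 1) + 0)"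
      proof -
        have "M + j + (2 * M - 1) * j + M = 2 * M * (j + 1) + 0" for j
          using M by (cases M) (simp_all add: algebra_simps)
        then show ?thesis by (simp only: cs mult_simps)
      qed
      then have "inv a = x [^] (M + (d * i + c)) \<otimes> y"
        unfolding x_periodic using cs y by (intro inv_equality) auto
      moreover have "d dvd M + d * i + 2 * M * c" using d d2 by simp
      then have "d dvd M + (d * i + c) + (2 * M - 1) * c" unfolding red by (simp add: add_ac)
      ultimately show ?thesis using coset_yI[OF d2] by simp
    qed
  next
    fix a b assume "a \<in> cyc d \<union> coset_y d c" "b \<in> cyc d \<union> coset_y d c"
    then consider (cc) i j where "a = x [^] (d * i)" "b = x [^] (d * j)"
      | (cy) i j where "a = x [^] (d * i)" "b = x [^] (d * j + c) \<otimes> y"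
      | (yc) i j where "a = x [^] (d * i + c) \<otimes> y" "b = x [^] (d * j)"
      | (yy) i j where "a = x [^] (d * i + c) \<otimes> y" "b = x [^] (d * j + c) \<otimes> y"
      by (auto simp: cyc_def coset_y_def)
    then show "a \<otimes> b \<in> cyc d \<union> coset_y d c"
    proof cases
      case cc
      then show ?thesis by (auto simp: mult_simps intro: cycI)
    next
      case cy
      have "d dvd d * i + d * j + 2 * M * c" using d2 by simp
      then have "d dvd d * i + (d * j + c) + (2 * M - 1) * c" unfolding red by (simp add: add_ac)
      then show ?thesis using cy coset_yI[OF d2] by (simp add: mult_simps)
    next
      case yc
      have "d dvd d * i + (2 * M - 1) * (d * j) + 2 * M * c" using d2 by simp
      then have "d dvd d * i + c + (2 * M - 1) * (d * j) + (2 * M - 1) * c"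
        unfolding red by (simp add: add_ac)
      then show ?thesis using yc coset_yI[OF d2] by (simp add: mult_simps)
    next
      case yy
      have "d dvd d * i + (2 * M - 1) * (d * j) + 2 * M * c + M" using d d2 by simp
      then have "d dvd d * i + c + (2 * M - 1) * (d * j + c) + M"
        unfolding red by (simp add: add_ac add_mult_distrib2)
      then show ?thesis using yy by (simp add: mult_simps cycI)
    qed
  }
qed

lemma generate_cyc: "generate G {x [^] d} = cyc d"
proof
  show "generate G {x [^] d} \<subseteq> cyc d"
    by (intro generate_subgroup_incl subgroup_cyc) (auto intro: cycI)
  interpret H: subgroup "generate G {x [^] d}" G by (rule generate_is_subgroup) auto
  have "(x [^] d) [^] i \<in> generate G {x [^] d}" for i :: nat
    by (induction i) (auto intro: generate.incl)
  then show "cyc d \<subseteq> generate G {x [^] d}"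
    using x by (auto simp: cyc_def nat_pow_pow)
qed

lemma generate_dicyclic:
  assumes d: "d dvd M"
  shows "generate G {x [^] d, x [^] c \<otimes> y} = cyc d \<union> coset_y d c"
proof
  show "generate G {x [^] d, x [^] c \<otimes> y} \<subseteq> cyc d \<union> coset_y d c"
    by (intro generate_subgroup_incl subgroup_dicyclic d)
       (auto intro: cycI simp: coset_y_def intro!: exI[of _ 0] image_eqI[of _ _ 0])
  interpret H: subgroup "generate G {x [^] d, x [^] c \<otimes> y}" G
    using y by (intro generate_is_subgroup) auto
  have pow: "x [^] (d * i) \<in> generate G {x [^] d, x [^] c \<otimes> y}" for i :: nat
  proof (induction i)
    case (Suc i)
    then have "x [^] (d * i) \<otimes> x [^] d \<in> generate G {x [^] d, x [^] c \<otimes> y}"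
      by (auto intro: generate.incl)
    then show ?case by (simp add: mult_simps add.commute)
  qed simp
  moreover have "x [^] (d * i + c) \<otimes> y \<in> generate G {x [^] d, x [^] c \<otimes> y}" for i :: nat
  proof -
    have "x [^] (d * i) \<otimes> (x [^] c \<otimes> y) \<in> generate G {x [^] d, x [^] c \<otimes> y}"
      using pow by (auto intro: generate.incl)
    then show ?thesis by (simp add: mult_simps)
  qed
  ultimately show "cyc d \<union> coset_y d c \<subseteq> generate G {x [^] d, x [^] c \<otimes> y}"
    by (auto simp: cyc_def coset_y_def)
qed

end

text \<open>The relations also hold in the trivial group. The added assumptions make the 4M normal
  forms distinct, so that sums over subgroups become sums over exponents.\<close>

locale quaternion_group = quaternion_relations +
  assumes x_inj: "\<And>i j. i < 2 * M \<Longrightarrow> j < 2 * M \<Longrightarrow> x [^] i = x [^] j \<Longrightarrow> i = j"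
    and y_notin: "\<And>i j. x [^] (i :: nat) \<noteq> x [^] (j :: nat) \<otimes> y"
begin

lemma bij_cyc:
  assumes d: "2 * M = d * r"
  shows "bij_betw (\<lambda>i. x [^] (d * i)) {..<r} (cyc d)"
proof (rule bij_betw_imageI)
  have "d > 0" using M d by (cases d) auto
  show "inj_on (\<lambda>i. x [^] (d * i)) {..<r}"
  proof (rule inj_onI)
    fix i j assume "i \<in> {..<r}" "j \<in> {..<r}" "x [^] (d * i) = x [^] (d * j)"
    then have "d * i = d * j" using \<open>d > 0\<close> by (intro x_inj) (auto simp: d)
    then show "i = j" using \<open>d > 0\<close> by simp
  qed
  have "x [^] (d * i) \<in> (\<lambda>i. x [^] (d * i)) ` {..<r}" for i
  proof -
    have "x [^] (d * i) = x [^] (d * (i mod r))"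
      by (subst x_pow_mod) (simp add: d)
    moreover have "i mod r < r" using M d by (cases r) auto
    ultimately show ?thesis by blast
  qed
  then show "(\<lambda>i. x [^] (d * i)) ` {..<r} = cyc d" by (auto simp: cyc_def)
qed

lemma bij_coset_y:
  assumes d: "2 * M = d * r"
  shows "bij_betw (\<lambda>i. x [^] (d * i + c) \<otimes> y) {..<r} (coset_y d c)"
proof -
  have "bij_betw (\<lambda>z. z \<otimes> (x [^] c \<otimes> y)) (cyc d) (coset_y d c)"
  proof (rule bij_betw_imageI)
    show "inj_on (\<lambda>z. z \<otimes> (x [^] c \<otimes> y)) (cyc d)"
      using y by (auto intro!: inj_onI simp: cyc_def)
    show "(\<lambda>z. z \<otimes> (x [^] c \<otimes> y)) ` cyc d = coset_y d c"
      by (auto simp: cyc_def coset_y_def image_image mult_simps)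
  qed
  from bij_betw_trans[OF bij_cyc[OF d] this] show ?thesis
    by (simp add: comp_def mult_simps)
qed

lemma cyc_coset_y_disjoint: "cyc d \<inter> coset_y d c = {}"
  using y_notin by (auto simp: cyc_def coset_y_def)

lemma sum_cyc:
  assumes "2 * M = d * r"
  shows "(\<Sum>k\<in>cyc d. g k) = (\<Sum>i<r. g (x [^] (d * i)))"
  using sum.reindex_bij_betw[OF bij_cyc[OF assms]] by (rule HOL.sym)

lemma sum_dicyclic:
  assumes d: "2 * M = d * r"
  shows "(\<Sum>k\<in>cyc d \<union> coset_y d c. g k)
    = (\<Sum>i<r. g (x [^] (d * i))) + (\<Sum>i<r. g (x [^] (d * i + c) \<otimes> y))"
proof -
  have "finite (cyc d)" "finite (coset_y d c)"
    using bij_cyc[OF d] bij_coset_y[OF d] by (auto dest: bij_betw_finite)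
  then have "(\<Sum>k\<in>cyc d \<union> coset_y d c. g k) = (\<Sum>k\<in>cyc d. g k) + (\<Sum>k\<in>coset_y d c. g k)"
    using cyc_coset_y_disjoint by (rule sum.union_disjoint)
  also have "(\<Sum>k\<in>coset_y d c. g k) = (\<Sum>i<r. g (x [^] (d * i + c) \<otimes> y))"
    using sum.reindex_bij_betw[OF bij_coset_y[OF d]] by (rule HOL.sym)
  finally show ?thesis by (simp add: sum_cyc[OF d])
qed

lemma card_cyc: "2 * M = d * r \<Longrightarrow> card (cyc d) = r"
  using bij_betw_same_card[OF bij_cyc] by fastforce

lemma card_dicyclic: "2 * M = d * r \<Longrightarrow> card (cyc d \<union> coset_y d c) = 2 * r"
  using sum_dicyclic[of d r "\<lambda>_. 1 :: nat"] by (simp add: card_eq_sum[symmetric])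

end

section \<open>The representations of the generalized quaternion group\<close>

definition mtrace :: "complex mat \<Rightarrow> complex" where
  "mtrace A = (\<Sum>k<dim_row A. A $$ (k, k))"

lemma mtrace_four_block:
  assumes "A \<in> carrier_mat m m" "B \<in> carrier_mat k k"
  shows "mtrace (four_block_mat A (0\<^sub>m m k) (0\<^sub>m k m) B) = mtrace A + mtrace B"
proof -
  have "mtrace (four_block_mat A (0\<^sub>m m k) (0\<^sub>m k m) B)
      = (\<Sum>i<m + k. if i < m then A $$ (i, i) else B $$ (i - m, i - m))"
    using assms unfolding mtrace_def by (intro sum.cong) auto
  also have "\<dots> = (\<Sum>i<m. A $$ (i, i)) + (\<Sum>i<k. B $$ (i, i))"
    by (induction k) (auto simp: add_ac)
  finally show ?thesis using assms by (simp add: mtrace_def)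
qed

lemma diag_block_mat_square:
  assumes "\<And>A. A \<in> set As \<Longrightarrow> square_mat A"
  shows "square_mat (diag_block_mat As)"
  using assms
proof (induction As)
  case (Cons A As)
  have "square_mat A" by (rule Cons.prems) simp
  moreover have "square_mat (diag_block_mat As)"
    by (rule Cons.IH, rule Cons.prems) simp
  ultimately show ?case by (simp add: Let_def)
qed simp

lemma mtrace_diag_block:
  assumes "\<And>A. A \<in> set As \<Longrightarrow> square_mat A"
  shows "mtrace (diag_block_mat As) = (\<Sum>A\<leftarrow>As. mtrace A)"
  using assms
proof (induction As)
  case (Cons A As)
  let ?B = "diag_block_mat As"
  have "square_mat A" by (rule Cons.prems) simp
  moreover have "square_mat ?B"
    by (rule diag_block_mat_square, rule Cons.prems) simp
  ultimately have "mtrace (four_block_mat A (0\<^sub>m (dim_row A) (dim_row ?B)) (0\<^sub>m (dim_row ?B) (dim_row A)) ?B)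
      = mtrace A + mtrace ?B"
    by (intro mtrace_four_block) auto
  then show ?case using Cons.IH Cons.prems \<open>square_mat A\<close> \<open>square_mat ?B\<close> by (simp add: Let_def)
qed (simp add: mtrace_def)

abbreviation mat1 :: "complex \<Rightarrow> complex mat" where
  "mat1 a \<equiv> mat_of_rows_list 1 [[a]]"

abbreviation mat2 :: "complex \<Rightarrow> complex \<Rightarrow> complex \<Rightarrow> complex \<Rightarrow> complex mat" where
  "mat2 a b c d \<equiv> mat_of_rows_list 2 [[a, b], [c, d]]"

lemma mat1_simps:
  "mat1 a \<in> carrier_mat 1 1" "mat1 a * mat1 b = mat1 (a * b)" "1\<^sub>m 1 = mat1 1" "square_mat (mat1 a)" "mtrace (mat1 a) = a"
  by (auto simp: mat_of_rows_list_def mtrace_def scalar_prod_def intro!: eq_matI)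

lemma mat2_simps:
  "mat2 a b c d \<in> carrier_mat 2 2"
  "mat2 a b c d * mat2 a' b' c' d'
    = mat2 (a * a' + b * c') (a * b' + b * d') (c * a' + d * c') (c * b' + d * d')"
  "1\<^sub>m 2 = mat2 1 0 0 1"
  "square_mat (mat2 a b c d)"
  "mtrace (mat2 a b c d) = a + d"
  "mat2 a b c d $$ (0, 0) = a"
  by (auto simp: mat_of_rows_list_def mtrace_def scalar_prod_def numeral_2_eq_2 less_Suc_eq intro!: eq_matI)

section \<open>Evaluating representations on the normal forms\<close>

lemma quat_x_pow: "quat_x n [^]\<^bsub>quat n\<^esub> k = word_class (quat_relators n) (replicate k (GX, True))"
proof (induction k)
  case (Suc k)
  then show ?case
    by (simp add: quat_def quat_x_def word_class_mult replicate_append_same)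
qed (simp add: quat_def word_class_one nat_pow_def)

lemma group_quat: "group (quat n)"
  unfolding quat_def by (rule group_presented_group)

lemma quat_x_pow_y:
  "quat_x n [^]\<^bsub>quat n\<^esub> k \<otimes>\<^bsub>quat n\<^esub> quat_y n
    = word_class (quat_relators n) (replicate k (GX, True) @ [(GY, True)])"
  unfolding quat_x_pow by (simp add: quat_def quat_y_def word_class_mult)

lemma quaternion_relations_quat:
  assumes n: "n \<ge> 2"
  shows "quaternion_relations (quat n) (quat_x n) (quat_y n) (2 ^ (n - 2))"
proof -
  interpret group "quat n" by (rule group_quat)
  let ?c = "word_class (quat_relators n)"
  have two: "2 * 2 ^ (n - 2) = (2 :: nat) ^ (n - 1)"
    using n by (simp flip: power_Suc add: Suc_diff_le)
  have one: "?c r = \<one>\<^bsub>quat n\<^esub>" if "r \<in> quat_relators n" for r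
    using that by (simp add: quat_def word_class_one word_class_eq_iff word_eq.relator)
  have mult: "?c u \<otimes>\<^bsub>quat n\<^esub> ?c v = ?c (u @ v)" for u v
    by (simp add: quat_def word_class_mult)
  have carr: "?c u \<in> carrier (quat n)" for u
    by (simp add: quat_def word_class_carrier)
  have "?c [(GY, False)] \<otimes>\<^bsub>quat n\<^esub> quat_y n = \<one>\<^bsub>quat n\<^esub>"
    using word_eq.cancel[of "quat_relators n" GY False]
    by (simp add: quat_y_def mult) (simp add: quat_def word_class_one word_class_eq_iff)
  then have inv: "inv\<^bsub>quat n\<^esub> (quat_y n) = ?c [(GY, False)]"
    by (intro inv_equality) (auto simp: quat_y_def carr)
  show ?thesis
  proof
    show "quat_x n [^]\<^bsub>quat n\<^esub> (2 * 2 ^ (n - 2) :: nat) = \<one>\<^bsub>quat n\<^esub>"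
      unfolding quat_x_pow two by (rule one) (simp add: quat_relators_def)
    show "quat_y n \<otimes>\<^bsub>quat n\<^esub> quat_y n \<otimes>\<^bsub>quat n\<^esub> quat_x n [^]\<^bsub>quat n\<^esub> (2 ^ (n - 2) :: nat) = \<one>\<^bsub>quat n\<^esub>"
      unfolding quat_x_pow quat_y_def mult by (rule one) (simp add: quat_relators_def)
    show "quat_y n \<otimes>\<^bsub>quat n\<^esub> quat_x n \<otimes>\<^bsub>quat n\<^esub> inv\<^bsub>quat n\<^esub> (quat_y n) \<otimes>\<^bsub>quat n\<^esub> quat_x n = \<one>\<^bsub>quat n\<^esub>"
      unfolding inv unfolding quat_x_def quat_y_def mult by (rule one) (simp add: quat_relators_def)
  qed (auto simp: quat_x_def quat_y_def carr)
qed

text \<open>\<open>P k\<close> is a closed formula for the k-th power of the matrix of x, so that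
  the relators can be checked entrywise; \<open>Y'\<close> is the inverse of
  \<open>Y\<close>.\<close>

lemma quat_rep_eval:
  fixes P :: "nat \<Rightarrow> complex mat"
  assumes carrier: "\<And>k. P k \<in> carrier_mat d d" "Y \<in> carrier_mat d d" "Y' \<in> carrier_mat d d"
    and P: "P 0 = 1\<^sub>m d" "\<And>i j. P i * P j = P (i + j)" "P (2 ^ (n - 1)) = 1\<^sub>m d"
    and Y: "Y * Y' = 1\<^sub>m d" "Y' * Y = 1\<^sub>m d"
    and YYP: "Y * Y * P (2 ^ (n - 2)) = 1\<^sub>m d" and YPYP: "Y * P 1 * Y' * P 1 = 1\<^sub>m d"
  shows "quat_rep d (P 1) Y (quat_x n [^]\<^bsub>quat n\<^esub> i) = P i"
    and "quat_rep d (P 1) Y (quat_x n [^]\<^bsub>quat n\<^esub> i \<otimes>\<^bsub>quat n\<^esub> quat_y n) = P i * Y"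
proof -
  let ?R = "ring_mat TYPE(complex) d ()"
  let ?f = "case_gen (P 1) Y"
  have "ring ?R" by (rule ring_mat)
  then interpret R: monoid ?R by (rule ring.is_monoid)
  note [simp] = ring_mat_simps
  \<comment> \<open>The inverse of \<open>P 1\<close> is the value of \<open>P\<close> one step
    before its period.\<close>
  have "P (2 ^ (n - 1) - 1) * P 1 = 1\<^sub>m d" "P 1 * P (2 ^ (n - 1) - 1) = 1\<^sub>m d"
    using P by (simp_all)
  then have unit_X: "P 1 \<in> Units ?R"
    using carrier unfolding Units_def by auto
  have unit_Y: "Y \<in> Units ?R"
    using carrier Y unfolding Units_def by auto
  have inv_Y: "inv\<^bsub>?R\<^esub> Y = Y'"
    using carrier Y by (intro R.inv_unique'[symmetric]) auto
  have unit: "?f a \<in> Units ?R" for a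
    using unit_X unit_Y by (cases a) auto
  have append: "word_eval ?R ?f (u @ v) = word_eval ?R ?f u * word_eval ?R ?f v" for u v
    using word_eval_append[of ?R ?f u v] R.monoid_axioms unit by simp
  have pow: "word_eval ?R ?f (replicate k (GX, True)) = P k" for k
    using P(1) P(2)[of 1] by (induction k) auto
  have closed: "word_eval ?R ?f u \<in> carrier_mat d d" for u
    using word_eval_closed[of ?R ?f u] R.monoid_axioms unit by simp
  have hom: "quat_rep d (P 1) Y (word_class (quat_relators n) w) = word_eval ?R ?f w" for w
    unfolding quat_rep_def
  proof (rule presented_hom_word_class)
    fix r assume "r \<in> quat_relators n"
    then consider (x) "r = replicate (2 ^ (n - 1)) (GX, True)"
      | (y) "r = [(GY, True), (GY, True)] @ replicate (2 ^ (n - 2)) (GX, True)"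
      | (yx) "r = [(GY, True), (GX, True), (GY, False), (GX, True)]"
      by (auto simp: quat_relators_def)
    then show "word_eval ?R ?f r = \<one>\<^bsub>?R\<^esub>"
    proof cases
      case x
      then show ?thesis by (simp add: pow P del: One_nat_def)
    next
      case y
      then have "word_eval ?R ?f r = Y * Y * P (2 ^ (n - 2))"
        unfolding y append pow using carrier by simp
      then show ?thesis using YYP by simp
    next
      case yx
      have "word_eval ?R ?f r = Y * (P 1 * (Y' * P 1))"
        unfolding yx using carrier right_mult_one_mat[OF carrier(1)] by (simp add: inv_Y del: One_nat_def)
      also have "\<dots> = Y * P 1 * Y' * P 1"
        using carrier(1)[of 1] carrier(2,3)
        by (simp add: assoc_mult_mat[of _ d d _ d _ d] mult_carrier_mat[of _ d d _ d] del: One_nat_def)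
      finally show ?thesis using YPYP by simp
    qed
  qed (use unit R.monoid_axioms in auto)
  show "quat_rep d (P 1) Y (quat_x n [^]\<^bsub>quat n\<^esub> i) = P i"
    unfolding quat_x_pow hom pow ..
  show "quat_rep d (P 1) Y (quat_x n [^]\<^bsub>quat n\<^esub> i \<otimes>\<^bsub>quat n\<^esub> quat_y n) = P i * Y"
    unfolding quat_x_pow_y hom append pow using carrier by simp
qed

lemma omega_eq_iff: "omega n ^ i = omega n ^ j \<longleftrightarrow> i mod 2 ^ (n - 1) = j mod 2 ^ (n - 1)"
proof -
  have "omega n ^ k = exp (2 * of_real pi * \<i> * of_nat k / of_nat (2 ^ (n - 1)))" for k
    unfolding omega_def by (simp add: exp_of_nat_mult[symmetric] mult_ac)
  then show ?thesis using complex_root_unity_eq[of "2 ^ (n - 1)" i j] by simp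
qed

lemma omega_power_one: "omega n ^ (2 ^ (n - 1)) = 1"
  using omega_eq_iff[of n "2 ^ (n - 1)" 0] by simp

lemma omega_power_minus_one:
  assumes "n \<ge> 2"
  shows "omega n ^ (2 ^ (n - 2)) = -1"
proof -
  have two: "(2 :: nat) ^ (n - 1) = 2 * 2 ^ (n - 2)"
    using assms by (simp flip: power_Suc add: Suc_diff_le)
  have "(omega n ^ (2 ^ (n - 2)))\<^sup>2 = 1"
    using omega_power_one[of n] unfolding two by (simp add: power_even_eq)
  moreover have "omega n ^ (2 ^ (n - 2)) \<noteq> 1"
    using omega_eq_iff[of n "2 ^ (n - 2)" 0] unfolding two by simp
  ultimately show ?thesis by (simp add: power2_eq_1_iff)
qed

lemma omega_cnj: "omega n * cnj (omega n) = 1"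
proof -
  have "norm (omega n) = 1"
    unfolding omega_def by (simp add: norm_exp_eq_Re Re_divide_of_nat)
  then show ?thesis by (simp add: complex_norm_square[symmetric])
qed

lemma Theta_eval:
  fixes i :: nat
  assumes n: "n \<ge> 2"
  shows "Theta n s (quat_x n [^]\<^bsub>quat n\<^esub> i) = mat2 (omega n ^ (s * i)) 0 0 (cnj (omega n) ^ (s * i))" (is ?X)
    and "Theta n s (quat_x n [^]\<^bsub>quat n\<^esub> i \<otimes>\<^bsub>quat n\<^esub> quat_y n)
      = mat2 0 ((- 1) ^ s * omega n ^ (s * i)) (cnj (omega n) ^ (s * i)) 0" (is ?Y)
proof -
  let ?w = "omega n"
  let ?P = "\<lambda>k. mat2 (?w ^ (s * k)) 0 0 (cnj ?w ^ (s * k))"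
  have w1: "?w ^ (s * 2 ^ (n - 1)) = 1" "cnj ?w ^ (s * 2 ^ (n - 1)) = 1"
    using omega_power_one[of n] complex_cnj_power[of "omega n" "2 ^ (n - 1)"]
    by (simp_all add: power_mult mult.commute[of s] del: One_nat_def)
  have w2: "?w ^ (s * 2 ^ (n - 2)) = (-1) ^ s" "cnj ?w ^ (s * 2 ^ (n - 2)) = (-1) ^ s"
    using omega_power_minus_one[OF n] complex_cnj_power[of "omega n" "2 ^ (n - 2)"]
    by (simp_all add: power_mult mult.commute[of s])
  have s2: "(-1) ^ s * (-1) ^ s = (1 :: complex)" by (cases "even s") auto
  have wc: "?w ^ s * cnj ?w ^ s = 1" "cnj ?w ^ s * ?w ^ s = 1"
    using omega_cnj[of n] by (simp_all flip: power_mult_distrib add: mult.commute)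
  note eval = quat_rep_eval[where P = ?P and d = 2 and Y = "mat2 0 ((- 1) ^ s) 1 0"
      and Y' = "mat2 0 1 ((- 1) ^ s) 0" and n = n and i = i]
  have X: "Theta n s = quat_rep 2 (?P 1) (mat2 0 ((- 1) ^ s) 1 0)"
    unfolding Theta_def by simp
  show ?X
    unfolding X
    by (rule eval(1))
       (simp_all add: mat2_simps w1 w2 s2 wc power_add algebra_simps del: One_nat_def)
  have "Theta n s (quat_x n [^]\<^bsub>quat n\<^esub> i \<otimes>\<^bsub>quat n\<^esub> quat_y n) = ?P i * mat2 0 ((- 1) ^ s) 1 0"
    unfolding X
    by (rule eval(2))
       (simp_all add: mat2_simps w1 w2 s2 wc power_add algebra_simps del: One_nat_def)
  then show ?Y by (simp add: mat2_simps mult.commute)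
qed

text \<open>\<open>u j\<close> and \<open>v j\<close> are the values at x and y. For n \<ge> 3 the
  exponent 2^(n-2) is even, as x \<mapsto> -1 requires in the relator y y x^(2^(n-2)).\<close>

lemma chi_eval:
  fixes i :: nat
  assumes n: "n \<ge> 3"
  defines "u \<equiv> \<lambda>j :: nat. if j \<in> {1, 2} then 1 else - 1 :: complex"
    and "v \<equiv> \<lambda>j :: nat. if j \<in> {1, 3} then 1 else - 1 :: complex"
  shows "chi j (quat_x n [^]\<^bsub>quat n\<^esub> i) = mat1 (u j ^ i)" (is ?X)
    and "chi j (quat_x n [^]\<^bsub>quat n\<^esub> i \<otimes>\<^bsub>quat n\<^esub> quat_y n) = mat1 (u j ^ i * v j)" (is ?Y)
proof -
  have "even ((2 :: nat) ^ (n - 1))" "even ((2 :: nat) ^ (n - 2))" using n by auto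
  then have u: "u j ^ (2 ^ (n - 1)) = 1" "u j ^ (2 ^ (n - 2)) = 1" "u j * u j = 1" "v j * v j = 1"
    by (auto simp: u_def v_def)
  note eval = quat_rep_eval[where P = "\<lambda>k. mat1 (u j ^ k)" and d = 1 and Y = "mat1 (v j)"
      and Y' = "mat1 (v j)" and n = n and i = i]
  have X: "chi j = quat_rep 1 (mat1 (u j ^ 1)) (mat1 (v j))"
    unfolding chi_def u_def v_def by simp
  have comm: "v j * u j * v j * u j = 1"
    using u by (metis mult.assoc mult.commute mult_1_left)
  show ?X
    unfolding X
    by (rule eval(1)) (simp_all add: mat1_simps u comm power_add del: One_nat_def)
  have "chi j (quat_x n [^]\<^bsub>quat n\<^esub> i \<otimes>\<^bsub>quat n\<^esub> quat_y n) = mat1 (u j ^ i) * mat1 (v j)"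
    unfolding X
    by (rule eval(2)) (simp_all add: mat1_simps u comm power_add del: One_nat_def)
  then show ?Y by (simp add: mat1_simps del: One_nat_def)
qed

text \<open>The upper left entry of \<open>Theta n 1\<close> is \<omega>^i on x^i and 0 on x^i y. It
  separates the powers of x below 2^(n-1) and tells the two kinds of normal form apart.\<close>

lemma quaternion_group_quat:
  assumes n: "n \<ge> 2"
  shows "quaternion_group (quat n) (quat_x n) (quat_y n) (2 ^ (n - 2))"
proof -
  interpret quaternion_relations "quat n" "quat_x n" "quat_y n" "2 ^ (n - 2)"
    by (rule quaternion_relations_quat[OF n])
  have two: "2 * 2 ^ (n - 2) = (2 :: nat) ^ (n - 1)"
    using n by (simp flip: power_Suc add: Suc_diff_le)
  show ?thesis
  proof
    fix i j :: nat
    assume "i < 2 * 2 ^ (n - 2)" "j < 2 * 2 ^ (n - 2)"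
      and eq: "quat_x n [^]\<^bsub>quat n\<^esub> i = quat_x n [^]\<^bsub>quat n\<^esub> j"
    moreover have "omega n ^ i = omega n ^ j"
      using arg_cong[OF eq, of "\<lambda>q. Theta n 1 q $$ (0, 0)"] by (simp add: Theta_eval[OF n] mat2_simps)
    ultimately show "i = j" unfolding omega_eq_iff two by simp
  next
    fix i j :: nat
    show "quat_x n [^]\<^bsub>quat n\<^esub> i \<noteq> quat_x n [^]\<^bsub>quat n\<^esub> j \<otimes>\<^bsub>quat n\<^esub> quat_y n"
    proof
      assume eq: "quat_x n [^]\<^bsub>quat n\<^esub> i = quat_x n [^]\<^bsub>quat n\<^esub> j \<otimes>\<^bsub>quat n\<^esub> quat_y n"
      have "omega n ^ i = 0"
        using arg_cong[OF eq, of "\<lambda>q. Theta n 1 q $$ (0, 0)"] by (simp add: Theta_eval[OF n] mat2_simps)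
      then show False using omega_cnj[of n] by simp
    qed
  qed
qed

lemma sum_list_concat_replicate:
  "(\<Sum>z\<leftarrow>concat (map (\<lambda>j. replicate (c j) (f j)) js). g z) = (\<Sum>j\<leftarrow>js. of_nat (c j) * (g (f j) :: complex))"
  by (induction js) (auto simp: sum_list_replicate)

lemma mtrace_rep_sum:
  assumes sq: "\<And>j. square_mat (chi j q)" "\<And>s. square_mat (Theta n s q)"
  shows "mtrace (rep_sum n a b q) = (\<Sum>j=1..<5. of_nat (a j) * mtrace (chi j q))
    + (\<Sum>s=1..<2 ^ (n - 2). of_nat (b s) * mtrace (Theta n s q))"
proof -
  have "mtrace (rep_sum n a b q) = (\<Sum>j\<leftarrow>[1..<5]. of_nat (a j) * mtrace (chi j q))
    + (\<Sum>s\<leftarrow>[1..<2 ^ (n - 2)]. of_nat (b s) * mtrace (Theta n s q))"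
    unfolding rep_sum_def using sq
    by (subst mtrace_diag_block) (auto simp del: upt_rec_numeral simp: sum_list_concat_replicate)
  then show ?thesis by (simp only: interv_sum_list_conv_sum_set_nat set_upt)
qed

lemma rep_trace_x:
  fixes i :: nat
  assumes n: "n \<ge> 3"
  shows "mtrace (rep_sum n a b (quat_x n [^]\<^bsub>quat n\<^esub> i))
    = of_nat (a 1 + a 2) + (-1) ^ i * of_nat (a 3 + a 4)
      + (\<Sum>s=1..<2 ^ (n - 2). of_nat (b s) * (omega n ^ (s * i) + cnj (omega n) ^ (s * i)))"
proof -
  have n2: "n \<ge> 2" using n by simp
  have "{1..<5} = {1, 2, 3, 4 :: nat}" by auto
  then show ?thesis
    by (subst mtrace_rep_sum)
       (auto simp del: square_mat.simps One_nat_def simp: chi_eval[OF n] Theta_eval[OF n2] mat1_simps mat2_simps algebra_simps)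
qed

text \<open>The matrices of \<Theta>_s at x^i y are antidiagonal, so the b_s drop out.\<close>

lemma rep_trace_xy:
  fixes i :: nat
  assumes n: "n \<ge> 3"
  shows "mtrace (rep_sum n a b (quat_x n [^]\<^bsub>quat n\<^esub> i \<otimes>\<^bsub>quat n\<^esub> quat_y n))
    = of_nat (a 1) - of_nat (a 2) + (-1) ^ i * (of_nat (a 3) - of_nat (a 4))"
proof -
  have n2: "n \<ge> 2" using n by simp
  have "{1..<5} = {1, 2, 3, 4 :: nat}" by auto
  then show ?thesis
    by (subst mtrace_rep_sum)
       (auto simp del: square_mat.simps One_nat_def simp: chi_eval[OF n] Theta_eval[OF n2] mat1_simps mat2_simps algebra_simps)
qed

section \<open>Multiplicities and character sums\<close>

lemma sum_powers_root_of_unity: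
  fixes z :: complex
  assumes "z ^ r = 1"
  shows "(\<Sum>i<r. z ^ i) = (if z = 1 then of_nat r else 0)"
  using assms by (auto simp: sum_gp_strict)

text \<open>Orthogonality on the cyclic group of order r generated by x^d, for the character x
  \<mapsto> \<omega>^k; it is trivial there exactly when r divides k.\<close>

lemma sum_omega_powers:
  assumes N: "2 ^ (n - 1) = d * r"
  shows "(\<Sum>i<r. omega n ^ (k * (d * i))) = (if r dvd k then of_nat r else 0)"
proof -
  have d: "d > 0" using N by (cases d) auto
  have "(\<Sum>i<r. omega n ^ (k * (d * i))) = (\<Sum>i<r. (omega n ^ (k * d)) ^ i)"
    by (simp add: power_mult mult.assoc[symmetric])
  also have "\<dots> = (if omega n ^ (k * d) = 1 then of_nat r else 0)"
  proof (rule sum_powers_root_of_unity)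
    have "(omega n ^ (k * d)) ^ r = (omega n ^ (d * r)) ^ k"
      by (simp add: mult_ac flip: power_mult)
    then show "(omega n ^ (k * d)) ^ r = 1"
      by (simp add: omega_power_one flip: N del: One_nat_def)
  qed
  also have "omega n ^ (k * d) = 1 \<longleftrightarrow> r dvd k"
    using omega_eq_iff[of n "k * d" 0] d unfolding N by (simp add: mod_eq_0_iff_dvd mult.commute[of k])
  finally show ?thesis .
qed

lemma cnj_omega_power:
  assumes "s \<le> 2 ^ (n - 1)"
  shows "cnj (omega n) ^ (s * i) = omega n ^ ((2 ^ (n - 1) - s) * i)"
proof -
  have "omega n ^ ((2 ^ (n - 1) - s) * i) * omega n ^ (s * i) = (omega n ^ (2 ^ (n - 1))) ^ i"
    using assms by (simp flip: power_add power_mult add_mult_distrib)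
  moreover have "cnj (omega n) ^ (s * i) * omega n ^ (s * i) = 1"
    using omega_cnj[of n] by (simp flip: power_mult_distrib add: mult.commute)
  moreover have "omega n \<noteq> 0" using omega_cnj[of n] by auto
  ultimately show ?thesis by (simp add: omega_power_one del: One_nat_def) (metis mult_right_cancel power_not_zero)
qed

text \<open>On powers of x the character combines the \<omega>^(e i) with e = 0, 2^(n-2), s and -s.
  For the given range of m, adding m to e gives a multiple of 2^(n-1) only for e = -m, so exactly
  one eigenvalue of \<Theta>_m survives.\<close>

lemma rep_trace_inversion:
  assumes n: "n \<ge> 3" and m: "0 < m" "m < 2 ^ (n - 2)"
  shows "(\<Sum>i<2 ^ (n - 1). mtrace (rep_sum n a b (quat_x n [^]\<^bsub>quat n\<^esub> i)) * omega n ^ (m * i))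
    = 2 ^ (n - 1) * of_nat (b m)"
proof -
  let ?w = "omega n" and ?N = "2 ^ (n - 1) :: nat" and ?M = "2 ^ (n - 2) :: nat"
  have two: "?N = 2 * ?M" using n by (simp flip: power_Suc add: Suc_diff_le)
  \<comment> \<open>With the sign written as a power of \<omega>, the single orthogonality relation
    \<open>S\<close> treats all summands.\<close>
  have minus: "(-1) ^ i = ?w ^ (?M * i)" for i
    using omega_power_minus_one[of n] n by (simp add: power_mult)
  have S: "(\<Sum>i<?N. ?w ^ (k * i)) = (if ?N dvd k then of_nat ?N else 0)" for k
    using sum_omega_powers[of n 1 ?N k] by simp
  have term_eq: "mtrace (rep_sum n a b (quat_x n [^]\<^bsub>quat n\<^esub> i)) * ?w ^ (m * i)
    = of_nat (a 1 + a 2) * ?w ^ (m * i) + of_nat (a 3 + a 4) * ?w ^ ((?M + m) * i)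
      + (\<Sum>s=1..<?M. of_nat (b s) * (?w ^ ((s + m) * i) + ?w ^ ((?N - s + m) * i)))" for i
  proof -
    have "of_nat (b s) * (?w ^ (s * i) + cnj ?w ^ (s * i)) * ?w ^ (m * i)
        = of_nat (b s) * (?w ^ ((s + m) * i) + ?w ^ ((?N - s + m) * i))" if "s \<in> {1..<?M}" for s
    proof -
      have "s \<le> ?N" using that two by auto
      then show ?thesis
        by (simp only: cnj_omega_power distrib_left distrib_right power_add add_mult_distrib mult.assoc)
    qed
    then have S2: "(\<Sum>s=1..<?M. of_nat (b s) * (?w ^ (s * i) + cnj ?w ^ (s * i))) * ?w ^ (m * i)
        = (\<Sum>s=1..<?M. of_nat (b s) * (?w ^ ((s + m) * i) + ?w ^ ((?N - s + m) * i)))"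
      unfolding sum_distrib_right by (rule sum.cong[OF HOL.refl])
    show ?thesis
      unfolding rep_trace_x[OF n] minus
      by (subst distrib_right, subst S2)
         (simp add: distrib_right power_add mult.assoc del: of_nat_add One_nat_def)
  qed
  have nd: "\<not> ?N dvd k" if "0 < k" "k < ?N" for k
    using that by (rule nat_dvd_not_less)
  have dvd1: "\<not> ?N dvd m" "\<not> ?N dvd ?M + m"
    by (rule nd; use m two in linarith)+
  have dvd2: "\<not> ?N dvd s + m" if "s \<in> {1..<?M}" for s
    by (rule nd; use that m two in simp)
  have dvd3: "?N dvd ?N - s + m \<longleftrightarrow> s = m" if "s \<in> {1..<?M}" for s
  proof
    assume "?N dvd ?N - s + m"
    then obtain k where k: "?N - s + m = ?N * k" by (auto elim: dvdE)
    have "0 < ?N - s + m" "?N - s + m < ?N * 2" using that m two by auto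
    then have "0 < k" "k < 2" unfolding k by simp_all
    then have "k = 1" by simp
    then show "s = m" using k that two by auto
  qed (use that two in auto)
  have S_sum: "(\<Sum>i<?N. ?w ^ ((s + m) * i) + ?w ^ ((?N - s + m) * i)) = (if s = m then of_nat ?N else 0)"
    if "s \<in> {1..<?M}" for s
    unfolding sum.distrib S dvd3[OF that] using dvd2[OF that] by simp
  have "(\<Sum>i<?N. mtrace (rep_sum n a b (quat_x n [^]\<^bsub>quat n\<^esub> i)) * ?w ^ (m * i))
    = of_nat (a 1 + a 2) * (\<Sum>i<?N. ?w ^ (m * i)) + of_nat (a 3 + a 4) * (\<Sum>i<?N. ?w ^ ((?M + m) * i))
      + (\<Sum>i<?N. \<Sum>s=1..<?M. of_nat (b s) * (?w ^ ((s + m) * i) + ?w ^ ((?N - s + m) * i)))"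
    unfolding term_eq sum.distrib[of _ _ "{..<?N}"] sum_distrib_left ..
  also have "\<dots> = (\<Sum>i<?N. \<Sum>s=1..<?M. of_nat (b s) * (?w ^ ((s + m) * i) + ?w ^ ((?N - s + m) * i)))"
    unfolding S using dvd1 by simp
  also have "\<dots> = (\<Sum>s=1..<?M. of_nat (b s) * (\<Sum>i<?N. ?w ^ ((s + m) * i) + ?w ^ ((?N - s + m) * i)))"
    by (subst sum.swap) (simp only: sum_distrib_left)
  also have "\<dots> = (\<Sum>s=1..<?M. of_nat (b s) * (if s = m then of_nat ?N else 0))"
    by (rule sum.cong[OF HOL.refl]) (simp only: S_sum)
  also have "\<dots> = of_nat ?N * of_nat (b m)"
    using m by (simp add: if_distrib sum.delta cong: if_cong)
  finally show ?thesis by simp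
qed

lemma multiplicities_conjugate:
  assumes n: "n \<ge> 3"
    and f: "\<And>i. mtrace (rep_sum n a b (quat_x n [^]\<^bsub>quat n\<^esub> i)) = of_real (f i)" "\<And>i::nat. f i \<in> \<rat>"
    and u: "odd u" "2 ^ v * u < 2 ^ (n - 2)"
  shows "b (2 ^ v * u) = b (2 ^ v)"
proof -
  let ?w = "omega n"
  have u0: "u > 0" using u(1) by (cases u) auto
  have v_le: "2 ^ v \<le> 2 ^ v * u" using u0 by simp
  then have v: "v < n - 2" using u(2) by (metis le_less_trans one_less_numeral_iff power_strict_increasing_iff semiring_norm(76))
  \<comment> \<open>Chosen so that \<omega>^(2^v) raised to 2^l is \<omega>^(2^(n-2)) = -1; a
    further odd exponent u keeps the value -1.\<close>
  define l where "l = n - 2 - v"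
  have z: "(?w ^ 2 ^ v) ^ 2 ^ l = -1"
    using omega_power_minus_one[of n] n v by (simp add: l_def flip: power_mult power_add)
  then have x: "(?w ^ (2 ^ v * u)) ^ 2 ^ l = -1"
    using u(1) by (simp add: power_mult mult.commute) (metis power_commutes power_mult mult.commute power_minus_odd power_one)
  \<comment> \<open>Subtracting its value at \<omega>^(2^v) from the constant coefficient makes the
    inversion polynomial vanish there, which is the situation of the conjugacy lemma.\<close>
  define r where "r i = (if i = 0 then f 0 - 2 ^ (n - 1) * b (2 ^ v) else f i)" for i
  have r: "(\<Sum>i<2 ^ (n - 1). of_real (r i) * (?w ^ m) ^ i)
    = 2 ^ (n - 1) * of_nat (b m) - 2 ^ (n - 1) * of_nat (b (2 ^ v))" if "0 < m" "m < 2 ^ (n - 2)" for m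
  proof -
    have "(\<Sum>i<2 ^ (n - 1). of_real (r i) * (?w ^ m) ^ i)
      = (\<Sum>i<2 ^ (n - 1). of_real (f i) * ?w ^ (m * i) - (if i = 0 then 2 ^ (n - 1) * of_nat (b (2 ^ v)) else 0))"
      by (intro sum.cong) (auto simp: r_def simp flip: power_mult)
    then show ?thesis
      using rep_trace_inversion[OF n that, of a b] by (simp add: f(1) sum_subtractf)
  qed
  have "(\<Sum>i<2 ^ (n - 1). of_real (r i) * (?w ^ (2 ^ v * u)) ^ i) = 0"
  proof (rule two_power_cyclotomic_conjugate[OF _ z x])
    show "r i \<in> \<rat>" for i unfolding r_def using f(2) by auto
    show "(\<Sum>i<2 ^ (n - 1). of_real (r i) * (?w ^ 2 ^ v) ^ i) = 0"
      using r[of "2 ^ v"] v by simp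
  qed
  then have "complex_of_nat (b (2 ^ v * u)) = of_nat (b (2 ^ v))"
    using r[of "2 ^ v * u"] u u0 by simp
  then show ?thesis by (simp only: of_nat_eq_iff)
qed

text \<open>\<Theta>_s restricted to the subgroup of order r of \<langle>x\<rangle> is trivial if r
  divides s and has no nonzero fixed vector otherwise. So this is half of what the \<Theta>_s
  contribute to the fixed space of that subgroup.\<close>

definition mult_sum :: "nat \<Rightarrow> (nat \<Rightarrow> nat) \<Rightarrow> nat \<Rightarrow> nat" where
  "mult_sum n b r = (\<Sum>s | s \<in> {1..<2 ^ (n - 2)} \<and> r dvd s. b s)"

lemma mult_sum_eq_0: "2 ^ (n - 2) \<le> r \<Longrightarrow> mult_sum n b r = 0"
  unfolding mult_sum_def by (intro sum.neutral) (auto dest!: dvd_imp_le)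

text \<open>The indices discarded between 2^v and 2^(v+1) are those of valuation exactly v, namely
  2^v (2 i + 1) with i < 2^(n-3-v), all with the same multiplicity.\<close>

lemma mult_sum_step:
  assumes b: "\<And>u. odd u \<Longrightarrow> 2 ^ v * u < 2 ^ (n - 2) \<Longrightarrow> b (2 ^ v * u) = b (2 ^ v)"
    and v: "v + 3 \<le> n"
  shows "mult_sum n b (2 ^ v) = mult_sum n b (2 ^ (v + 1)) + 2 ^ (n - 3 - v) * b (2 ^ v)"
proof -
  let ?S = "\<lambda>P. {s :: nat. s \<in> {1..<2 ^ (n - 2)} \<and> P s}" and ?k = "2 ^ (n - 3 - v) :: nat"
  have M: "2 ^ (n - 2) = 2 ^ v * (2 * ?k)"
  proof -
    have "n - 2 = v + Suc (n - 3 - v)" using v by simp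
    then show ?thesis by (metis power_Suc power_add)
  qed
  have "?S (\<lambda>s. 2 ^ v dvd s \<and> \<not> 2 ^ (v + 1) dvd s) = (\<lambda>i. 2 ^ v * (2 * i + 1)) ` {..<?k}"
  proof (intro equalityI subsetI)
    fix s assume "s \<in> ?S (\<lambda>s. 2 ^ v dvd s \<and> \<not> 2 ^ (v + 1) dvd s)"
    then obtain u where u: "s = 2 ^ v * u" "\<not> 2 ^ v * 2 dvd 2 ^ v * u" "s < 2 ^ (n - 2)"
      by (auto elim!: dvdE simp: mult.commute)
    then have "odd u" by (auto simp: dvd_mult_cancel1)
    then obtain i where i: "u = 2 * i + 1" by (auto elim: oddE)
    then have "i < ?k" using u(3) unfolding u(1) i M mult_less_cancel1 by simp
    then show "s \<in> (\<lambda>i. 2 ^ v * (2 * i + 1)) ` {..<?k}" using u i by auto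
  next
    fix s :: nat assume "s \<in> (\<lambda>i. 2 ^ v * (2 * i + 1)) ` {..<?k}"
    then obtain i where i: "i < ?k" "s = 2 ^ v * (2 * i + 1)" by auto
    have "\<not> 2 ^ (v + 1) dvd s"
    proof
      assume "2 ^ (v + 1) dvd s"
      then have "2 ^ v * 2 dvd 2 ^ v * (2 * i + 1)" using i by (simp add: mult.commute)
      then have "2 dvd 2 * i + 1" by (subst (asm) nat_mult_dvd_cancel_disj) simp
      then show False by simp
    qed
    moreover have "2 * i + 1 < 2 * ?k" using i(1) by simp
    then have "s < 2 ^ (n - 2)" unfolding i(2) M mult_less_cancel1 by simp
    moreover have "s \<noteq> 0" "2 ^ v dvd s" unfolding i(2) by simp_all
    then have "1 \<le> s" "2 ^ v dvd s" by simp_all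
    ultimately show "s \<in> ?S (\<lambda>s. 2 ^ v dvd s \<and> \<not> 2 ^ (v + 1) dvd s)" by simp
  qed
  moreover have "b (2 ^ v * (2 * i + 1)) = b (2 ^ v)" if "i < ?k" for i
  proof (rule b)
    have "2 * i + 1 < 2 * ?k" using that by simp
    then show "2 ^ v * (2 * i + 1) < 2 ^ (n - 2)" unfolding M mult_less_cancel1 by simp
  qed simp
  moreover have "inj_on (\<lambda>i. 2 ^ v * (2 * i + 1)) {..<?k}" by (auto intro!: inj_onI)
  ultimately have "(\<Sum>s\<in>?S (\<lambda>s. 2 ^ v dvd s \<and> \<not> 2 ^ (v + 1) dvd s). b s) = ?k * b (2 ^ v)"
    by (simp add: sum.reindex del: One_nat_def)
  moreover have "?S (\<lambda>s. 2 ^ v dvd s) = ?S (\<lambda>s. 2 ^ (v + 1) dvd s) \<union> ?S (\<lambda>s. 2 ^ v dvd s \<and> \<not> 2 ^ (v + 1) dvd s)"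
    by (auto dest: dvd_mult_right simp: mult.commute intro: power_le_dvd)
  moreover have "sum b (?S (\<lambda>s. 2 ^ (v + 1) dvd s) \<union> ?S (\<lambda>s. 2 ^ v dvd s \<and> \<not> 2 ^ (v + 1) dvd s))
    = sum b (?S (\<lambda>s. 2 ^ (v + 1) dvd s)) + sum b (?S (\<lambda>s. 2 ^ v dvd s \<and> \<not> 2 ^ (v + 1) dvd s))"
    by (rule sum.union_disjoint) auto
  ultimately show ?thesis
    unfolding mult_sum_def by (simp only:)
qed

section \<open>Sums of the character over cyclic subgroups and their cosets\<close>

lemma sum_alternating_powers:
  assumes "n \<ge> 2" "2 ^ (n - 1) = d * r"
  shows "(\<Sum>i<r. (-1) ^ (d * i)) = (if even d then of_nat r else 0 :: complex)"
proof (cases "even d")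
  case False
  have "even ((2 :: nat) ^ (n - 1))" using assms(1) by simp
  then have "even r" unfolding assms(2) using False by simp
  then have "(\<Sum>i<r. (-1) ^ i) = (0 :: complex)"
    using sum_powers_root_of_unity[of "-1" r] by simp
  then show ?thesis using False by (simp add: power_mult)
qed (simp add: power_mult)

text \<open>Each \<Theta>_s with r dividing s counts twice; \<chi>_3 and \<chi>_4 count if x^d lies
  in their kernel, that is for even d.\<close>

lemma rep_trace_sum_x:
  assumes n: "n \<ge> 3" and N: "2 ^ (n - 1) = d * r"
  shows "(\<Sum>i<r. mtrace (rep_sum n a b (quat_x n [^]\<^bsub>quat n\<^esub> (d * i))))
    = of_nat (r * (a 1 + a 2 + 2 * mult_sum n b r + (if even d then a 3 + a 4 else 0)))"
    (is "?lhs = _")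
proof -
  let ?w = "omega n" and ?M = "2 ^ (n - 2) :: nat"
  have two: "(2 :: nat) ^ (n - 1) = 2 * ?M" using n by (simp flip: power_Suc add: Suc_diff_le)
  have S: "(\<Sum>i<r. ?w ^ (s * (d * i)) + cnj ?w ^ (s * (d * i))) = (if r dvd s then 2 * of_nat r else 0)"
    if s: "s \<in> {1..<?M}" for s
  proof -
    have le: "s \<le> 2 ^ (n - 1)" using s two by auto
    have "r dvd 2 ^ (n - 1) - s \<longleftrightarrow> r dvd s"
      using le by (metis N dvd_diff_nat dvd_triv_right diff_diff_cancel)
    then show ?thesis
      using sum_omega_powers[OF N, of s] sum_omega_powers[OF N, of "2 ^ (n - 1) - s"]
      by (simp add: sum.distrib cnj_omega_power[OF le] del: One_nat_def)
  qed
  have "(\<Sum>i<r. mtrace (rep_sum n a b (quat_x n [^]\<^bsub>quat n\<^esub> (d * i))))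
    = of_nat r * of_nat (a 1 + a 2) + (\<Sum>i<r. (-1) ^ (d * i)) * of_nat (a 3 + a 4)
      + (\<Sum>s=1..<?M. of_nat (b s) * (\<Sum>i<r. ?w ^ (s * (d * i)) + cnj ?w ^ (s * (d * i))))"
    unfolding rep_trace_x[OF n]
    by (simp add: sum.distrib sum_distrib_right sum_distrib_left distrib_left sum.swap[of _ "{1..<?M}"]
        del: of_nat_add One_nat_def)
  also have "(\<Sum>s=1..<?M. of_nat (b s) * (\<Sum>i<r. ?w ^ (s * (d * i)) + cnj ?w ^ (s * (d * i))))
    = (\<Sum>s=1..<?M. if r dvd s then of_nat (b s) * (2 * of_nat r) else 0)"
    by (intro sum.cong HOL.refl) (simp add: S)
  also have "\<dots> = of_nat (2 * r * mult_sum n b r)"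
    unfolding mult_sum_def
    by (simp add: sum.inter_filter[symmetric] sum_distrib_left mult_ac)
  also have "(\<Sum>i<r. (-1) ^ (d * i)) = (if even d then of_nat r else 0 :: complex)"
    by (rule sum_alternating_powers[OF _ N]) (use n in simp)
  finally have E: "?lhs = of_nat r * of_nat (a 1 + a 2)
    + (if even d then of_nat r else 0) * of_nat (a 3 + a 4) + of_nat (2 * r * mult_sum n b r)" .
  show ?thesis unfolding E by (simp add: algebra_simps)
qed

lemma rep_trace_sum_xy:
  assumes n: "n \<ge> 3" and N: "2 ^ (n - 1) = d * r"
  shows "(\<Sum>i<r. mtrace (rep_sum n a b (quat_x n [^]\<^bsub>quat n\<^esub> (d * i + c) \<otimes>\<^bsub>quat n\<^esub> quat_y n)))
    = of_nat r * (of_nat (a 1) - of_nat (a 2) + (if even d then (-1) ^ c * (of_nat (a 3) - of_nat (a 4)) else 0))"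
    (is "?lhs = _")
proof -
  have "(\<Sum>i<r. mtrace (rep_sum n a b (quat_x n [^]\<^bsub>quat n\<^esub> (d * i + c) \<otimes>\<^bsub>quat n\<^esub> quat_y n)))
    = of_nat r * (of_nat (a 1) - of_nat (a 2)) + (\<Sum>i<r. (-1) ^ (d * i)) * ((-1) ^ c * (of_nat (a 3) - of_nat (a 4)))"
    unfolding rep_trace_xy[OF n]
    by (simp add: sum.distrib sum_distrib_right power_add mult.assoc)
  also have "(\<Sum>i<r. (-1) ^ (d * i)) = (if even d then of_nat r else 0 :: complex)"
    by (rule sum_alternating_powers[OF _ N]) (use n in simp)
  finally have E: "?lhs = of_nat r * (of_nat (a 1) - of_nat (a 2))
    + (if even d then of_nat r else 0) * ((-1) ^ c * (of_nat (a 3) - of_nat (a 4)))" .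
  show ?thesis unfolding E by (simp add: algebra_simps)
qed

section \<open>The action on the abelian variety\<close>

lemma complex_torus_discrete_subgroup: "complex_torus A \<Longrightarrow> discrete_subgroup (periods A)"
  by (simp add: complex_torus_def discrete_subgroup_def)

text \<open>The difference of two lifts takes values in the periods, and shrinking the argument
  would make a nonzero value shorter than the gap. This justifies the definite description in
  \<open>analytic_rep\<close>.\<close>

lemma analytic_lift_unique:
  assumes A: "discrete_subgroup (periods A)" and F: "clinear F" "clinear F'"
    and FF: "\<And>v. torus_proj A (F v) = torus_proj A (F' v)"
  shows "F = F'"
proof (rule ext, rule ccontr)
  fix v assume "F v \<noteq> F' v"
  define D where "D = F v - F' v"
  have D: "D \<noteq> 0" using \<open>F v \<noteq> F' v\<close> by (simp add: D_def)
  obtain e where e: "e > 0" "\<And>u. u \<in> periods A \<Longrightarrow> norm u < e \<Longrightarrow> u = 0"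
    using discrete_subgroup_gap[OF A] by auto
  define r where "r = e / (2 * norm D)"
  have "r *\<^sub>R D = F (r *\<^sub>R v) - F' (r *\<^sub>R v)"
    using F[THEN clinear_imp_linear] by (simp add: D_def linear_cmul scaleR_diff_right)
  then have "r *\<^sub>R D \<in> periods A"
    using FF torus_proj_eq_iff[OF A] by metis
  moreover have "norm (r *\<^sub>R D) < e" using D e(1) by (simp add: r_def)
  ultimately have "r *\<^sub>R D = 0" by (rule e(2))
  then show False using D e(1) by (simp add: r_def)
qed

lemma torus_Aut_mult:
  assumes "f \<in> carrier (torus_Aut A)" "g \<in> carrier (torus_Aut A)" "p \<in> torus_points A"
  shows "(f \<otimes>\<^bsub>torus_Aut A\<^esub> g) p = f (g p)"
  using assms by (simp add: torus_Aut_def BijGroup_def compose_def)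

lemma analytic_rep_eqI:
  assumes A: "discrete_subgroup (periods A)" and F: "clinear F" "\<And>v. f (torus_proj A v) = torus_proj A (F v)"
  shows "analytic_rep A f = F"
  unfolding analytic_rep_def
proof (rule the_equality)
  fix F' assume F': "clinear F' \<and> (\<forall>v. f (torus_proj A v) = torus_proj A (F' v))"
  then have "clinear F'" by blast
  then show "F' = F"
    using F' F(2) by (intro analytic_lift_unique[OF A _ F(1)]) simp_all
qed (use F in blast)

lemma analytic_rep_Aut:
  assumes A: "discrete_subgroup (periods A)" "tangent A = UNIV" and f: "f \<in> carrier (torus_Aut A)"
  shows "clinear (analytic_rep A f)"
    and "f (torus_proj A v) = torus_proj A (analytic_rep A f v)"
    and "analytic_rep A f ` periods A \<subseteq> periods A"
proof -
  have "torus_hom A A f" using f by (simp add: torus_Aut_def)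
  then obtain F where F: "clinear F" "F ` periods A \<subseteq> periods A"
      and "\<forall>v\<in>tangent A. f (torus_proj A v) = torus_proj A (F v)"
    unfolding torus_hom_def by (elim exE conjE)
  then have f_F: "f (torus_proj A v) = torus_proj A (F v)" for v using A(2) by simp
  have "analytic_rep A f = F" by (rule analytic_rep_eqI[OF A(1) F(1) f_F])
  then show "clinear (analytic_rep A f)" "f (torus_proj A v) = torus_proj A (analytic_rep A f v)"
      "analytic_rep A f ` periods A \<subseteq> periods A"
    using F f_F by simp_all
qed

lemma analytic_rep_mult:
  assumes A: "discrete_subgroup (periods A)" "tangent A = UNIV"
    and f: "f \<in> carrier (torus_Aut A)" and g: "g \<in> carrier (torus_Aut A)"
  shows "analytic_rep A (f \<otimes>\<^bsub>torus_Aut A\<^esub> g) = analytic_rep A f \<circ> analytic_rep A g"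
proof (rule analytic_rep_eqI[OF A(1)])
  show "clinear (analytic_rep A f \<circ> analytic_rep A g)"
    using analytic_rep_Aut(1)[OF A] f g by (blast intro: Vector_Spaces.linear_compose)
  have "torus_proj A v \<in> torus_points A" for v using A(2) by (simp add: torus_points_def)
  then show "(f \<otimes>\<^bsub>torus_Aut A\<^esub> g) (torus_proj A v)
      = torus_proj A ((analytic_rep A f \<circ> analytic_rep A g) v)" for v
    using f g by (simp add: torus_Aut_mult analytic_rep_Aut(2)[OF A])
qed

text \<open>If t were even, \<sigma> would send \<omega>^(2^(n-2)) = -1 to 1, which is already the
  image of 1, against injectivity.\<close>

lemma galois_generator_odd:
  assumes n: "n \<ge> 2" and t: "galois_generator n s t"
  shows "odd t"
proof
  assume "even t"
  let ?K = "adjoin {omega n}" and ?M = "2 ^ (n - 2) :: nat"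
  obtain \<sigma> where \<sigma>: "\<sigma> \<in> Gal ?K" "\<sigma> (omega n) = omega n ^ t"
    using t unfolding galois_generator_def by blast
  have hom: "\<sigma> \<in> Ring.ring_hom (complex_field\<lparr>carrier := ?K\<rparr>) (complex_field\<lparr>carrier := ?K\<rparr>)"
    and inj: "inj_on \<sigma> ?K"
    using \<sigma>(1) by (auto simp: Gal_def ring_iso_def Bij_def bij_betw_def)
  have one: "1 \<in> ?K"
    using generate_field.one[of complex_field "{omega n}"] by (simp add: adjoin_def complex_field_def)
  have pow: "omega n ^ k \<in> ?K" for k
  proof (induction k)
    case (Suc k)
    have "omega n \<in> ?K" by (simp add: adjoin_def generate_field.incl)
    then show ?case
      using Suc generate_field.eng_mult[of "omega n" complex_field "{omega n}" "omega n ^ k"]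
      by (simp add: adjoin_def complex_field_def)
  qed (simp add: one)
  have \<sigma>_pow: "\<sigma> (omega n ^ k) = omega n ^ (t * k)" for k
  proof (induction k)
    case 0
    then show ?case using ring_hom_one[OF hom] by (simp add: complex_field_def)
  next
    case (Suc k)
    then show ?case
      using ring_hom_mult[OF hom, of "omega n" "omega n ^ k"] pow[of 1] pow[of k] \<sigma>(2)
      by (simp add: complex_field_def power_add)
  qed
  have "\<sigma> (omega n ^ ?M) = \<sigma> (omega n ^ 0)"
    using \<open>even t\<close> omega_power_minus_one[OF n]
    unfolding \<sigma>_pow by (simp add: mult.commute[of t] power_mult)
  then have "omega n ^ ?M = omega n ^ 0" using inj pow by (meson inj_onD)
  then show False using omega_power_minus_one[OF n] by simp
qed

section \<open>The representation on the tangent space\<close>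

locale quaternion_action =
  fixes n :: nat and A :: "'g::finite torus"
    and G :: "((complex ^ 'g) set \<Rightarrow> (complex ^ 'g) set) set"
    and \<phi> :: "gen word set \<Rightarrow> (complex ^ 'g) set \<Rightarrow> (complex ^ 'g) set"
    and a b :: "nat \<Rightarrow> nat"
  assumes n: "n \<ge> 3"
    and torus: "complex_torus A" "tangent A = UNIV"
    and G: "subgroup G (torus_Aut A)"
    and iso: "\<phi> \<in> iso (quat n) ((torus_Aut A)\<lparr>carrier := G\<rparr>)"
    and rho: "rep_equiv (quat n) (\<lambda>q. analytic_rep A (\<phi> q)) (rep_sum n a b)"
begin

sublocale Q: quaternion_group "quat n" "quat_x n" "quat_y n" "2 ^ (n - 2)"
  by (rule quaternion_group_quat) (use n in simp)

abbreviation L :: "gen word set \<Rightarrow> complex ^ 'g \<Rightarrow> complex ^ 'g" where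
  "L q \<equiv> analytic_rep A (\<phi> q)"

lemmas discrete_periods = complex_torus_discrete_subgroup[OF torus(1)]

lemma phi_Aut: "q \<in> carrier (quat n) \<Longrightarrow> \<phi> q \<in> carrier (torus_Aut A)"
  using iso subgroup.subset[OF G] by (auto simp: iso_def hom_def)

lemmas L_linear = analytic_rep_Aut(1)[OF discrete_periods torus(2) phi_Aut]

lemma phi_mult:
  "p \<in> carrier (quat n) \<Longrightarrow> q \<in> carrier (quat n) \<Longrightarrow>
    \<phi> (p \<otimes>\<^bsub>quat n\<^esub> q) = \<phi> p \<otimes>\<^bsub>torus_Aut A\<^esub> \<phi> q"
  using iso by (simp add: iso_def hom_def)

lemma L_mult:
  "p \<in> carrier (quat n) \<Longrightarrow> q \<in> carrier (quat n) \<Longrightarrow> L (p \<otimes>\<^bsub>quat n\<^esub> q) = L p \<circ> L q"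
  by (simp add: phi_mult analytic_rep_mult[OF discrete_periods torus(2)] phi_Aut)

text \<open>\<open>\<phi>\<close> maps the unit to an idempotent bijection of the points, and such a
  map is the identity.\<close>

lemma L_one: "L \<one>\<^bsub>quat n\<^esub> = (\<lambda>v. v)"
proof (rule analytic_rep_eqI[OF discrete_periods vec.linear_ident])
  fix v
  let ?e = "\<phi> \<one>\<^bsub>quat n\<^esub>" and ?p = "torus_proj A v"
  have e: "?e \<in> carrier (torus_Aut A)" by (simp add: phi_Aut)
  then have bij: "bij_betw ?e (torus_points A) (torus_points A)"
    by (simp add: torus_Aut_def Bij_def)
  have p: "?p \<in> torus_points A" using torus(2) by (simp add: torus_points_def)
  have "?e (?e ?p) = ?e ?p"
    using phi_mult[of "\<one>\<^bsub>quat n\<^esub>" "\<one>\<^bsub>quat n\<^esub>"] torus_Aut_mult[OF e e p] by simp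
  then show "?e ?p = ?p"
    using bij p by (metis bij_betw_def bij_betw_apply inj_onD)
qed

lemma ctrace_L:
  assumes q: "q \<in> carrier (quat n)"
  shows "ctrace (L q) = mtrace (rep_sum n a b q)"
proof -
  obtain es where es: "distinct es" "vec.independent (set es)" "vec.span (set es) = UNIV"
    and M: "\<forall>q\<in>carrier (quat n). rep_sum n a b q \<in> carrier_mat (length es) (length es) \<and>
        (\<forall>k<length es. L q (es ! k) = (\<Sum>i<length es. rep_sum n a b q $$ (i, k) *s es ! i))"
    using rho unfolding rep_equiv_def by blast
  have "ctrace (L q) = (\<Sum>k<length es. rep_sum n a b q $$ (k, k))"
    using M q by (intro ctrace_matrix[OF L_linear[OF q] es]) blast
  moreover have "dim_row (rep_sum n a b q) = length es" using M q by blast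
  ultimately show ?thesis by (simp add: mtrace_def)
qed

text \<open>On powers of x the two eigenvalues of each \<Theta>_s are conjugate to each other, so
  nothing is lost in passing to the real part, which is what the lattice controls.\<close>

lemma trace_rational:
  fixes i :: nat
  defines "z \<equiv> mtrace (rep_sum n a b (quat_x n [^]\<^bsub>quat n\<^esub> i))"
  shows "z = of_real (Re z)" "Re z \<in> \<rat>"
proof -
  have "cnj z = z"
    unfolding z_def rep_trace_x[OF n] by (simp add: add.commute)
  then show "z = of_real (Re z)" by (simp add: complex_eq_iff)
  have q: "quat_x n [^]\<^bsub>quat n\<^esub> i \<in> carrier (quat n)" by simp
  note lin = L_linear[OF q]
  have "(\<Sum>e\<in>Basis. L (quat_x n [^]\<^bsub>quat n\<^esub> i) e \<bullet> e) \<in> \<rat>"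
    using torus analytic_rep_Aut(3)[OF discrete_periods torus(2) phi_Aut[OF q]]
    by (intro lattice_trace_rational[OF discrete_periods _ clinear_imp_linear[OF lin]])
       (simp_all add: complex_torus_def)
  then have "2 * Re z \<in> \<rat>"
    by (simp add: real_trace_eq_ctrace[OF lin] ctrace_L[OF q] z_def)
  then have "2 * Re z / 2 \<in> \<rat>" by (intro Rats_divide) auto
  then show "Re z \<in> \<rat>" by simp
qed

lemma multiplicity_eq: "odd u \<Longrightarrow> 2 ^ v * u < 2 ^ (n - 2) \<Longrightarrow> b (2 ^ v * u) = b (2 ^ v)"
  by (rule multiplicities_conjugate[OF n trace_rational])

lemma mult_sum_eq: "v + 3 \<le> n \<Longrightarrow> mult_sum n b (2 ^ v) = mult_sum n b (2 ^ (v + 1)) + 2 ^ (n - 3 - v) * b (2 ^ v)"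
  by (rule mult_sum_step[OF multiplicity_eq])

text \<open>Left multiplication by an element of K permutes K, so the sum \<open>?F\<close>
  satisfies the hypothesis of \<open>ctrace_multiple_of_projection\<close> with
  \<open>c = of_nat (card K)\<close>. The last two claims are what \<open>prym_dim\<close> asks of
  each variety.\<close>

lemma fixed_part_dim:
  assumes K: "subgroup K (quat n)" "finite K"
  shows "of_nat (card K * torus_dim (fixed_part A \<phi> K)) = (\<Sum>k\<in>K. mtrace (rep_sum n a b k))"
    and "vec.subspace (tangent (fixed_part A \<phi> K))"
    and "discrete_subgroup (periods (fixed_part A \<phi> K))"
proof -
  interpret K: subgroup K "quat n" by (rule K)
  let ?F = "\<lambda>v. \<Sum>k\<in>K. L k v"
  have F: "clinear ?F"
    by (intro vec.linear_compose_sum ballI L_linear K.mem_carrier)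
  have shift: "(\<Sum>l\<in>K. L k (L l v)) = ?F v" if k: "k \<in> K" for k v
  proof -
    have "(\<Sum>l\<in>K. L k (L l v)) = (\<Sum>l\<in>K. L (k \<otimes>\<^bsub>quat n\<^esub> l) v)"
      using k by (intro sum.cong HOL.refl) (simp add: L_mult)
    also have "\<dots> = ?F v"
      using k
      by (intro sum.reindex_bij_witness[of _ "\<lambda>l. inv\<^bsub>quat n\<^esub> k \<otimes>\<^bsub>quat n\<^esub> l" "\<lambda>l. k \<otimes>\<^bsub>quat n\<^esub> l"])
         (auto simp: Q.inv_solve_left Q.m_assoc[symmetric])
    finally show ?thesis .
  qed
  have "?F (?F v) = of_nat (card K) *s ?F v" for v
  proof -
    have "?F (?F v) = (\<Sum>k\<in>K. \<Sum>l\<in>K. L k (L l v))"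
    proof (rule sum.cong[OF HOL.refl])
      fix k assume "k \<in> K"
      then interpret Lk: Vector_Spaces.linear "(*s)" "(*s)" "L k"
        by (intro L_linear K.mem_carrier)
      show "L k (?F v) = (\<Sum>l\<in>K. L k (L l v))" by (rule Lk.sum)
    qed
    also have "\<dots> = (\<Sum>k\<in>K. ?F v)" by (simp add: shift)
    finally show ?thesis by (simp add: Finite_Cartesian_Product.vec_eq_iff of_nat_index)
  qed
  moreover have "card K \<noteq> 0" using K(2) K.one_closed by (metis card_eq_0_iff empty_iff)
  ultimately have "ctrace ?F = of_nat (card K) * of_nat (vec.dim (range ?F))"
    by (intro ctrace_multiple_of_projection[OF F]) simp_all
  then show "of_nat (card K * torus_dim (fixed_part A \<phi> K)) = (\<Sum>k\<in>K. mtrace (rep_sum n a b k))"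
    using torus(2) by (simp add: ctrace_sum ctrace_L torus_dim_def fixed_part_def torus_image_def)
  interpret F: Vector_Spaces.linear "(*s)" "(*s)" ?F by (rule F)
  show sub: "vec.subspace (tangent (fixed_part A \<phi> K))"
    using F.subspace_image[OF vec.subspace_UNIV] torus(2) by (simp add: fixed_part_def torus_image_def)
  have "periods (fixed_part A \<phi> K) = tangent (fixed_part A \<phi> K) \<inter> periods A"
    by (simp add: fixed_part_def torus_image_def)
  then show "discrete_subgroup (periods (fixed_part A \<phi> K))"
    using sub discrete_periods
    by (auto simp: discrete_subgroup_def vec.subspace_0 vec.subspace_diff intro: discrete_subset)
qed

section \<open>Dimensions of the fixed parts of the named subgroups\<close>

lemma two_M: "2 * 2 ^ (n - 2) = (2 :: nat) ^ (n - 1)"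
  using n by (simp flip: power_Suc add: Suc_diff_le)

lemma finite_cyc: "2 ^ (n - 1) = d * r \<Longrightarrow> finite (Q.cyc d)"
  using Q.bij_cyc[of d r] by (simp only: two_M) (auto dest: bij_betw_finite)

lemma finite_coset_y: "2 ^ (n - 1) = d * r \<Longrightarrow> finite (Q.coset_y d c)"
  using Q.bij_coset_y[of d r] by (simp only: two_M) (auto dest: bij_betw_finite)

lemma dim_cyc:
  assumes N: "2 ^ (n - 1) = d * r"
  shows "torus_dim (fixed_part A \<phi> (Q.cyc d))
    = a 1 + a 2 + 2 * mult_sum n b r + (if even d then a 3 + a 4 else 0)"
proof -
  have N': "2 * 2 ^ (n - 2) = d * r" using N two_M by simp
  have "r > 0" using N by (cases r) auto
  have "of_nat (r * torus_dim (fixed_part A \<phi> (Q.cyc d)))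
    = complex_of_nat (r * (a 1 + a 2 + 2 * mult_sum n b r + (if even d then a 3 + a 4 else 0)))"
    using fixed_part_dim(1)[OF Q.subgroup_cyc finite_cyc[OF N]]
    unfolding Q.card_cyc[OF N'] Q.sum_cyc[OF N'] rep_trace_sum_x[OF n N] .
  then show ?thesis using \<open>r > 0\<close> unfolding of_nat_eq_iff by simp
qed

text \<open>On the coset a_2 enters negatively and the \<Theta>_s not at all. Adding the cyclic part
  cancels a_2, halves the weight of \<open>mult_sum\<close>, and for even d keeps whichever of
  \<chi>_3, \<chi>_4 is 1 at x^c y.\<close>

lemma dim_dicyclic:
  assumes N: "2 ^ (n - 1) = d * r" and d: "d dvd 2 ^ (n - 2)"
  shows "torus_dim (fixed_part A \<phi> (Q.cyc d \<union> Q.coset_y d c))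
    = a 1 + mult_sum n b r + (if even d then if even c then a 3 else a 4 else 0)"
proof -
  have N': "2 * 2 ^ (n - 2) = d * r" using N two_M by simp
  have "r > 0" using N by (cases r) auto
  have fin: "finite (Q.cyc d \<union> Q.coset_y d c)"
    using finite_cyc[OF N] finite_coset_y[OF N] by simp
  have "of_nat (2 * r * torus_dim (fixed_part A \<phi> (Q.cyc d \<union> Q.coset_y d c)))
    = of_nat (r * (a 1 + a 2 + 2 * mult_sum n b r + (if even d then a 3 + a 4 else 0)))
      + complex_of_nat r * (of_nat (a 1) - of_nat (a 2)
        + (if even d then (-1) ^ c * (of_nat (a 3) - of_nat (a 4)) else 0))"
    using fixed_part_dim(1)[OF Q.subgroup_dicyclic[OF d] fin]
    unfolding Q.card_dicyclic[OF N'] Q.sum_dicyclic[OF N'] rep_trace_sum_x[OF n N] rep_trace_sum_xy[OF n N] .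
  also have "\<dots> = of_nat (2 * r * (a 1 + mult_sum n b r + (if even d then if even c then a 3 else a 4 else 0)))"
    by (simp add: algebra_simps)
  finally show ?thesis using \<open>r > 0\<close> unfolding of_nat_eq_iff by simp
qed

text \<open>A itself is not given as a \<open>fixed_part\<close>; its dimension is the trace of the
  identity, written as a sum over the trivial group with d = 2^(n-1) and r = 1.\<close>

lemma dim_A: "torus_dim A = a 1 + a 2 + 2 * mult_sum n b 1 + a 3 + a 4"
proof -
  have N: "2 ^ (n - 1) = 2 ^ (n - 1) * (1 :: nat)" by simp
  have "of_nat (torus_dim A) = ctrace (L \<one>\<^bsub>quat n\<^esub>)"
    using ctrace_multiple_of_projection[of "\<lambda>v :: complex ^ 'g. v" 1] torus(2)
    by (simp add: L_one torus_dim_def vec.linear_ident)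
  also have "\<dots> = mtrace (rep_sum n a b (quat_x n [^]\<^bsub>quat n\<^esub> (0 :: nat)))"
    by (subst ctrace_L) simp_all
  also have "\<dots> = of_nat (a 1 + a 2 + 2 * mult_sum n b 1 + (a 3 + a 4))"
    using rep_trace_sum_x[OF n N, of a b] n by simp
  finally show ?thesis unfolding of_nat_eq_iff by simp
qed

lemma sub_H_eq: "2 \<le> j \<Longrightarrow> sub_H n j = Q.cyc (2 ^ (n - j)) \<union> Q.coset_y (2 ^ (n - j)) 0"
  using Q.generate_dicyclic[of "2 ^ (n - j)" 0] Q.y by (simp add: sub_H_def le_imp_power_dvd)

lemma sub_Ht_eq: "2 \<le> j \<Longrightarrow> sub_Ht n j = Q.cyc (2 ^ (n - j)) \<union> Q.coset_y (2 ^ (n - j)) 1"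
  using Q.generate_dicyclic[of "2 ^ (n - j)" 1] Q.x by (simp add: sub_Ht_def le_imp_power_dvd)

lemma sub_Z_eq: "sub_Z n = Q.cyc (2 ^ (n - 2))"
  using Q.generate_cyc by (simp add: sub_Z_def Q.yy)

lemma sub_N_1_eq: "sub_N n 1 = Q.cyc 1"
  using Q.generate_cyc[of 1] Q.x by (simp add: sub_N_def)

text \<open>That the normal forms exhaust the group is an induction over words; formal inverses of
  letters are handled by closure of the right-hand side under inverses.\<close>

lemma carrier_eq: "carrier (quat n) = Q.cyc 1 \<union> Q.coset_y 1 0"
proof
  interpret H: subgroup "Q.cyc 1 \<union> Q.coset_y 1 0" "quat n"
    by (rule Q.subgroup_dicyclic) simp
  show "Q.cyc 1 \<union> Q.coset_y 1 0 \<subseteq> carrier (quat n)" by (rule H.subset)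
  let ?c = "word_class (quat_relators n)"
  have mult: "?c u \<otimes>\<^bsub>quat n\<^esub> ?c v = ?c (u @ v)" for u v
    by (simp add: quat_def word_class_mult)
  have carr: "?c u \<in> carrier (quat n)" for u
    by (simp add: quat_def word_class_carrier)
  have pos: "?c [(g, True)] \<in> Q.cyc 1 \<union> Q.coset_y 1 0" for g
  proof (cases g)
    case GX
    have "quat_x n [^]\<^bsub>quat n\<^esub> (1 :: nat) \<in> Q.cyc 1" by (rule Q.cycI) simp
    then show ?thesis using GX Q.x by (simp add: quat_x_def)
  next
    case GY
    have "quat_x n [^]\<^bsub>quat n\<^esub> (0 :: nat) \<otimes>\<^bsub>quat n\<^esub> quat_y n \<in> Q.coset_y 1 0"
      by (rule Q.coset_yI) simp_all
    then show ?thesis using GY Q.y by (simp add: quat_y_def)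
  qed
  have neg: "?c [(g, False)] = inv\<^bsub>quat n\<^esub> ?c [(g, True)]" for g
  proof -
    have "?c [(g, False)] \<otimes>\<^bsub>quat n\<^esub> ?c [(g, True)] = \<one>\<^bsub>quat n\<^esub>"
      using word_eq.cancel[of "quat_relators n" g False]
      unfolding mult by (simp add: quat_def word_class_one word_class_eq_iff)
    then show ?thesis using carr by (metis Q.inv_equality)
  qed
  have "?c w \<in> Q.cyc 1 \<union> Q.coset_y 1 0" for w
  proof (induction w)
    case Nil
    have "?c [] = \<one>\<^bsub>quat n\<^esub>" by (simp add: quat_def word_class_one)
    then show ?case using H.one_closed by simp
  next
    case (Cons l w)
    obtain g e where l: "l = (g, e)" by fastforce
    have "?c [l] \<in> Q.cyc 1 \<union> Q.coset_y 1 0"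
      unfolding l using pos[of g] neg[of g] by (cases e) (simp_all only: H.m_inv_closed)
    then have "?c [l] \<otimes>\<^bsub>quat n\<^esub> ?c w \<in> Q.cyc 1 \<union> Q.coset_y 1 0" using Cons by (rule H.m_closed)
    then show ?case unfolding mult by simp
  qed
  then show "carrier (quat n) \<subseteq> Q.cyc 1 \<union> Q.coset_y 1 0"
    by (auto simp: quat_def elim!: presented_group_cases)
qed

lemma subgroup_H: "2 \<le> j \<Longrightarrow> subgroup (sub_H n j) (quat n)"
  by (simp add: sub_H_eq Q.subgroup_dicyclic le_imp_power_dvd)

lemma subgroup_Ht: "2 \<le> j \<Longrightarrow> subgroup (sub_Ht n j) (quat n)"
  by (simp add: sub_Ht_eq Q.subgroup_dicyclic le_imp_power_dvd)

lemma two_power_split: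
  assumes "1 \<le> j" "j \<le> n"
  shows "2 ^ (n - 1) = 2 ^ (n - j) * (2 :: nat) ^ (j - 1)"
proof -
  have "n - 1 = (n - j) + (j - 1)" using assms by simp
  then show ?thesis by (metis power_add)
qed

text \<open>The cyclic part has order 2^(j-1), and j < n makes d = 2^(n-j) even. The surviving sign
  character is \<chi>_3, which is 1 at y; for the twisted groups it is \<chi>_4, which is 1 at x
  y.\<close>

lemma dim_H:
  assumes "2 \<le> j" "j < n"
  shows "torus_dim (fixed_part A \<phi> (sub_H n j)) = a 1 + a 3 + mult_sum n b (2 ^ (j - 1))"
  using assms dim_dicyclic[OF two_power_split[of j], of 0]
  by (simp add: sub_H_eq le_imp_power_dvd)

lemma dim_Ht:
  assumes "2 \<le> j" "j < n"
  shows "torus_dim (fixed_part A \<phi> (sub_Ht n j)) = a 1 + a 4 + mult_sum n b (2 ^ (j - 1))"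
  using assms dim_dicyclic[OF two_power_split[of j], of 1]
  by (simp add: sub_Ht_eq le_imp_power_dvd)

text \<open>The cyclic part has order 2^(n-1) for N_1 and 2^(n-2) for N_2 and N_3. No index s <
  2^(n-2) is divisible by it, so no \<Theta>_s remains.\<close>

lemma dim_N:
  assumes "i \<in> {1..3}"
  shows "torus_dim (fixed_part A \<phi> (sub_N n i)) = a 1 + a (i + 1)"
proof -
  have zero: "mult_sum n b (2 ^ (n - 1)) = 0" "mult_sum n b (2 ^ (n - 2)) = 0"
    by (simp_all add: mult_sum_eq_0)
  have sub: "n - 1 - 1 = n - 2" by simp
  consider "i = 1" | "i = 2" | "i = 3" using assms by force
  then show ?thesis
  proof cases
    case 1
    then show ?thesis
      unfolding 1 sub_N_1_eq using dim_cyc[of 1 "2 ^ (n - 1)"] zero by (simp add: numeral_2_eq_2)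
  next
    case 2
    then show ?thesis
      using dim_H[of "n - 1", unfolded sub] n zero by (simp add: sub_N_def)
  next
    case 3
    then show ?thesis
      using dim_Ht[of "n - 1", unfolded sub] n zero by (simp add: sub_N_def)
  qed
qed

lemma subgroup_N: "subgroup (sub_N n i) (quat n)"
proof (cases "i = 1")
  case True
  show ?thesis unfolding True sub_N_1_eq by (rule Q.subgroup_cyc)
next
  case False
  then show ?thesis using n subgroup_H[of "n - 1"] subgroup_Ht[of "n - 1"] by (simp add: sub_N_def)
qed

lemma finite_carrier: "finite (carrier (quat n))"
  unfolding carrier_eq using finite_cyc[of 1] finite_coset_y[of 1] by simp

lemma dim_G: "torus_dim (fixed_part A \<phi> (carrier (quat n))) = a 1"
  unfolding carrier_eq using dim_dicyclic[of 1 "2 ^ (n - 1)" 0] by (simp add: mult_sum_eq_0)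

lemma dim_Z: "torus_dim (fixed_part A \<phi> (sub_Z n)) = a 1 + a 2 + a 3 + a 4 + 2 * mult_sum n b 2"
  using dim_cyc[of "2 ^ (n - 2)" 2] n two_M by (simp add: sub_Z_eq)

lemma prym_fixed_part_dim:
  assumes P: "is_prym (fixed_part A \<phi> K) (fixed_part A \<phi> K') P"
    and K: "subgroup K (quat n)" "subgroup K' (quat n)"
  shows "torus_dim (fixed_part A \<phi> K) = torus_dim P + torus_dim (fixed_part A \<phi> K')"
proof -
  have "finite K" "finite K'"
    using K[THEN subgroup.subset] finite_carrier by (auto intro: finite_subset)
  then show ?thesis
    by (intro prym_dim[OF P] fixed_part_dim K)
qed

lemma prym_A_dim:
  assumes P: "is_prym A (fixed_part A \<phi> (sub_Z n)) P"
  shows "torus_dim A = torus_dim P + torus_dim (fixed_part A \<phi> (sub_Z n))"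
proof -
  have Z: "subgroup (sub_Z n) (quat n)" unfolding sub_Z_eq by (rule Q.subgroup_cyc)
  then have "finite (sub_Z n)"
    using subgroup.subset finite_carrier by (auto intro: finite_subset)
  then show ?thesis
    using Z torus(2) by (intro prym_dim[OF P] fixed_part_dim discrete_periods) simp_all
qed

text \<open>Reducing and folding an index of valuation j - 1 keeps its valuation, so
  \<open>multiplicity_eq\<close> applies to the representative.\<close>

lemma multiplicity_Theta_index:
  assumes j: "j \<in> {2..n - 2}" and t: "odd t"
  shows "b (Theta_index n (t ^ k * 2 ^ (j - 1))) = b (2 ^ (j - 1))"
proof -
  \<comment> \<open>\<open>u\<close>, and after folding \<open>w\<close>, is the cofactor of
    2^(j-1): reducing modulo 2^(n-1) = 2^(n-j) 2^(j-1) acts on it as reduction modulo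
    2^(n-j).\<close>
  define u where "u = t ^ k mod 2 ^ (n - j)"
  define w where "w = min u (2 ^ (n - j) - u)"
  have split: "2 ^ (n - 1) = 2 ^ (n - j) * (2 :: nat) ^ (j - 1)"
    using j by (intro two_power_split) auto
  have j': "2 \<le> j" "j + 2 \<le> n" using j n by (auto simp: le_diff_conv2)
  then have "n - j = Suc (n - j - 1)" "n - j - 1 \<noteq> 0" by simp_all
  then have half: "2 ^ (n - j) = 2 * (2 :: nat) ^ (n - j - 1)" "even ((2 :: nat) ^ (n - j - 1))"
    by (metis power_Suc, simp)
  have "t ^ k mod 2 = 1" using t by (metis odd_iff_mod_2_eq_one even_power)
  moreover have "t ^ k mod 2 ^ (n - j) mod 2 = t ^ k mod 2"
    by (intro mod_mod_cancel) (simp add: half)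
  ultimately have "u mod 2 = 1" by (simp only: u_def)
  then have "odd u" by presburger
  moreover have "u < 2 ^ (n - j)" by (simp add: u_def)
  ultimately have w: "odd w" "w \<le> 2 ^ (n - j - 1)"
    unfolding w_def half(1) by (auto simp: min_def)
  \<comment> \<open>The midpoint of the folding is even because j \<le> n - 2, so the odd
    \<open>w\<close> stays strictly below it.\<close>
  then have "w \<noteq> 2 ^ (n - j - 1)" using half(2) by blast
  then have "w < 2 ^ (n - j - 1)" using w(2) by simp
  then have "2 ^ (j - 1) * w < 2 ^ (j - 1) * 2 ^ (n - j - 1)" by simp
  also have "\<dots> = 2 ^ (n - 2)"
  proof -
    have "j - 1 + (n - j - 1) = n - 2" using j' by auto
    then show ?thesis by (metis power_add)
  qed
  finally have "b (2 ^ (j - 1) * w) = b (2 ^ (j - 1))"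
    by (intro multiplicity_eq w(1))
  moreover have red: "t ^ k * 2 ^ (j - 1) mod 2 ^ (n - 1) = u * 2 ^ (j - 1)"
    unfolding split u_def by (rule mod_mult_mult2)
  have "Theta_index n (t ^ k * 2 ^ (j - 1)) = min (u * 2 ^ (j - 1)) ((2 ^ (n - j) - u) * 2 ^ (j - 1))"
    unfolding Theta_index_def red unfolding split diff_mult_distrib ..
  then have "Theta_index n (t ^ k * 2 ^ (j - 1)) = 2 ^ (j - 1) * w"
    unfolding w_def nat_mult_min_left[symmetric] by (simp only: mult.commute)
  ultimately show ?thesis by simp
qed

end

theorem proposition1:
  fixes n :: nat
    and A :: "'g::finite torus"
    and G :: "((complex ^ 'g) set \<Rightarrow> (complex ^ 'g) set) set"
    and \<phi> :: "gen word set \<Rightarrow> (complex ^ 'g) set \<Rightarrow> (complex ^ 'g) set"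
    and a b t :: "nat \<Rightarrow> nat"
  assumes n: "n \<ge> 4"
    and A: "abelian_variety A" "tangent A = UNIV"
    and G: "subgroup G (torus_Aut A)"
    and iso: "\<phi> \<in> iso (quat n) ((torus_Aut A)\<lparr>carrier := G\<rparr>)"
    and rho: "rep_equiv (quat n) (\<lambda>q. analytic_rep A (\<phi> q)) (rep_sum n a b)"
    and t: "\<And>j. j \<in> {2..n - 2} \<Longrightarrow> t j < 2 ^ (n - 1) \<and> galois_generator n (2 ^ (j - 1)) (t j)"
  shows "(\<forall>s\<in>{1..2 ^ (n - 2) - 1}. odd s \<longrightarrow> b s = b 1) \<and>
    (\<forall>j\<in>{2..n - 2}. \<forall>k\<in>{0..2 ^ (n - j - 2) - 1}.
      b (2 ^ (j - 1)) = b (Theta_index n (t j ^ k * 2 ^ (j - 1)))) \<and>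
    torus_dim (fixed_part A \<phi> (carrier (quat n))) = a 1 \<and>
    (\<forall>i\<in>{1..3}. \<forall>P.
      is_prym (fixed_part A \<phi> (sub_N n i)) (fixed_part A \<phi> (carrier (quat n))) P \<longrightarrow>
      torus_dim P = a (i + 1)) \<and>
    (\<forall>P. is_prym A (fixed_part A \<phi> (sub_Z n)) P \<longrightarrow> torus_dim P = 2 ^ (n - 2) * b 1) \<and>
    (\<forall>j\<in>{2..n - 2}.
      (\<forall>P. is_prym (fixed_part A \<phi> (sub_H n j)) (fixed_part A \<phi> (sub_H n (j + 1))) P \<longrightarrow>
        torus_dim P = 2 ^ (n - j - 2) * b (2 ^ (j - 1))) \<and>
      (\<forall>P. is_prym (fixed_part A \<phi> (sub_Ht n j)) (fixed_part A \<phi> (sub_Ht n (j + 1))) P \<longrightarrow>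
        torus_dim P = 2 ^ (n - j - 2) * b (2 ^ (j - 1))))"
proof -
  interpret quaternion_action n A G \<phi> a b
    by (rule quaternion_action.intro) (use n A G iso rho in \<open>simp_all add: abelian_variety_def\<close>)
  have "b s = b 1" if "s \<in> {1..2 ^ (n - 2) - 1}" "odd s" for s
  proof -
    have "s \<le> 2 ^ (n - 2) - 1" "(0 :: nat) < 2 ^ (n - 2)" using that by simp_all
    then have "s < 2 ^ (n - 2)" by linarith
    then show ?thesis using multiplicity_eq[of s 0] that by simp
  qed
  moreover have "b (2 ^ (j - 1)) = b (Theta_index n (t j ^ k * 2 ^ (j - 1)))" if "j \<in> {2..n - 2}" for j k
    using multiplicity_Theta_index[OF that galois_generator_odd[OF _ conjunct2[OF t[OF that]]]] n by simp
  moreover have "torus_dim P = a (i + 1)"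
    if "i \<in> {1..3}" "is_prym (fixed_part A \<phi> (sub_N n i)) (fixed_part A \<phi> (carrier (quat n))) P" for i P
    using prym_fixed_part_dim[OF that(2) subgroup_N Q.subgroup_self] dim_N[OF that(1)] dim_G by simp
  moreover have "torus_dim P = 2 ^ (n - 2) * b 1" if "is_prym A (fixed_part A \<phi> (sub_Z n)) P" for P
  proof -
    \<comment> \<open>The step from \<open>mult_sum n b 1\<close> to \<open>mult_sum n b 2\<close>
      accounts for 2^(n-3) b_1, and the degree two of the \<Theta>_s doubles it.\<close>
    have "(2 :: nat) ^ (n - 2) = 2 * 2 ^ (n - 3)" using n by (simp flip: power_Suc add: Suc_diff_le)
    then show ?thesis
      using prym_A_dim[OF that] mult_sum_eq[of 0] n by (simp add: dim_A dim_Z)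
  qed
  moreover have "torus_dim P = 2 ^ (n - j - 2) * b (2 ^ (j - 1))"
    if j: "j \<in> {2..n - 2}"
      and P: "is_prym (fixed_part A \<phi> (sub_H n j)) (fixed_part A \<phi> (sub_H n (j + 1))) P \<or>
        is_prym (fixed_part A \<phi> (sub_Ht n j)) (fixed_part A \<phi> (sub_Ht n (j + 1))) P" for j P
  proof -
    have j': "2 \<le> j" "j + 2 \<le> n" using j n by (auto simp: le_diff_conv2)
    then have "j - 1 + 3 \<le> n" "n - 3 - (j - 1) = n - j - 2" "j - 1 + 1 = j" by auto
    then have "mult_sum n b (2 ^ (j - 1)) = mult_sum n b (2 ^ j) + 2 ^ (n - j - 2) * b (2 ^ (j - 1))"
      using mult_sum_eq[of "j - 1"] by (simp only:)
    moreover have "j < n" "2 \<le> j + 1" "j + 1 < n" using j' by auto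
    \<comment> \<open>The summands a_1 and a_3, respectively a_1 and a_4, are common to both fixed
      parts and cancel.\<close>
    ultimately show ?thesis
      using P j' prym_fixed_part_dim[of "sub_H n j" "sub_H n (j + 1)" P]
        prym_fixed_part_dim[of "sub_Ht n j" "sub_Ht n (j + 1)" P]
      by (auto simp: dim_H dim_Ht subgroup_H subgroup_Ht)
  qed
  ultimately show ?thesis using dim_G by blast
qed

end
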